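(* Let $\mathcal{O}\subset\mathcal{A}\subset\mathbb{R}^n$ be closed convex sets with non-empty interior, let $\Gamma\subset\mathrm{Conv}(\mathbb{R}^n)$ be an $(\mathcal{A},\mathcal{O})$-cone, let $V$ be a Hausdorff real topological vector space, and let $d\in\mathbb{N}$. For every $Z\in\mathrm{PV}_d(\Gamma,V)$ there exist unique continuous $k$-homogeneous valuations $Z_k\in\mathrm{PV}_d(\Gamma,V)$, $k\in\{0,1,\dots,n+d\}$, such that $$Z=\sum_{k=0}^{n+d}Z_k.$$
   Context: $\mathrm{Conv}(\mathbb{R}^n)$ is the set of convex, lower semi-continuous functions $f:\mathbb{R}^n\to\mathbb{R}\cup\{\infty\}$ that are proper (not identically $\infty$), with the metrizable topology of epi-convergence: $f_j\to f$ iff for every $x$, (i) $f(x)\le\liminf_j f_j(x_j)$ for every sequence $x_j\to x$, and (ii) there is a sequence $x_j\to x$ with $f(x)=\lim_j f_j(x_j)$. Subsets carry the induced topology. $\operatorname{dom}f=\{x:f(x)<\infty\}$; $I_A$ is the function equal to $0$ on $A$ and $\infty$ off $A$. $\mathcal{K}^{n+1}$ is the set of non-empty compact convex subsets of $\mathbb{R}^{n+1}=\mathbb{R}^n\times\mathbb{R}$, and $h_K(z)=\sup_{w\in K}\langle z,w\rangle$ is the support function. $\Gamma\subset\mathrm{Conv}(\mathbb{R}^n)$ is an $(\mathcal{A},\mathcal{O})$-cone if: $\Gamma$ is closed under pointwise addition and multiplication by $t>0$; $\mathcal{O}\subset\operatorname{dom}f\subset\mathcal{A}$ for every $f\in\Gamma$;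 $I_{\mathcal{A}},I_{\mathcal{O}}\in\Gamma$; and $h_K(\cdot,-1)+I_{\mathcal{A}}\in\Gamma$ for every $K\in\mathcal{K}^{n+1}$. A map $Z:\Gamma\to V$ is a valuation if $Z(f\vee h)+Z(f\wedge h)=Z(f)+Z(h)$ whenever $f,h,f\vee h,f\wedge h\in\Gamma$ (pointwise maximum and minimum). It is polynomial of degree at most $d$ if for every $f\in\Gamma$ the map $\ell\mapsto Z(f+\ell)$ is a ($V$-valued) polynomial of degree at most $d$ on the space $\mathrm{Aff}(n)\cong\mathbb{R}^{n+1}$ of affine functions $\ell:\mathbb{R}^n\to\mathbb{R}$. $\mathrm{PV}_d(\Gamma,V)$ is the space of continuous valuations $Z:\Gamma\to V$ that are polynomial of degree at most $d$. $Z$ is $k$-homogeneous if $Z(tf)=t^kZ(f)$ for all $t>0$, $f\in\Gamma$. *)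

theory Defs
  imports "HOL-Analysis.Analysis"
begin

section \<open>Real topological vector spaces\<close>

text \<open>No separation axiom is built into this class; being Hausdorff is expressed separately by
  the class \<^class>\<open>t2_space\<close>.\<close>

class real_tvs = real_vector + topological_ab_group_add +
  assumes tendsto_scaleR_Pair:
    "filterlim (\<lambda>p. fst p *\<^sub>R snd p) (nhds (a *\<^sub>R x)) (nhds a \<times>\<^sub>F nhds x)"

instance real_normed_vector \<subseteq> real_tvs
proof
  fix a :: real and x :: 'a
  show "filterlim (\<lambda>p. fst p *\<^sub>R snd p) (nhds (a *\<^sub>R x)) (nhds a \<times>\<^sub>F nhds x)"
    by (intro tendsto_scaleR filterlim_fst filterlim_snd)
qed


section \<open>Extended-valued convex functions\<close>

definition convex_ereal :: "('a::real_vector \<Rightarrow> ereal) \<Rightarrow> bool" where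
  "convex_ereal f \<longleftrightarrow> (\<forall>x y. \<forall>t\<in>{0<..<1::real}.
     f ((1 - t) *\<^sub>R x + t *\<^sub>R y) \<le> ereal (1 - t) * f x + ereal t * f y)"

definition lower_semicont :: "('a::topological_space \<Rightarrow> ereal) \<Rightarrow> bool" where
  "lower_semicont f \<longleftrightarrow> (\<forall>x. f x \<le> Liminf (at x) f)"

definition Conv :: "('a::euclidean_space \<Rightarrow> ereal) set" where
  "Conv = {f. (\<forall>x. f x \<noteq> -\<infinity>) \<and> (\<exists>x. f x \<noteq> \<infinity>) \<and> convex_ereal f \<and> lower_semicont f}"

definition edom :: "('a \<Rightarrow> ereal) \<Rightarrow> 'a set" where
  "edom f = {x. f x < \<infinity>}"

definition convex_indicator :: "'a set \<Rightarrow> 'a \<Rightarrow> ereal" where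
  "convex_indicator A x = (if x \<in> A then 0 else \<infinity>)"

text \<open>Only meant for non-empty bounded \<open>K\<close>: otherwise the real supremum is a junk value.\<close>

definition support_fun :: "'a::real_inner set \<Rightarrow> 'a \<Rightarrow> real" where
  "support_fun K z = (SUP w\<in>K. z \<bullet> w)"


section \<open>The topology of epi-convergence\<close>

definition epi_converges :: "(nat \<Rightarrow> 'a::topological_space \<Rightarrow> ereal) \<Rightarrow> ('a \<Rightarrow> ereal) \<Rightarrow> bool" where
  "epi_converges F f \<longleftrightarrow>
     (\<forall>x. (\<forall>xs. xs \<longlonglongrightarrow> x \<longrightarrow> f x \<le> liminf (\<lambda>j. F j (xs j))) \<and>
          (\<exists>xs. xs \<longlonglongrightarrow> x \<and> (\<lambda>j. F j (xs j)) \<longlonglongrightarrow> f x))"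

text \<open>A metrizable topology is determined by its convergent sequences: its open sets are the
  sequentially open ones. It is shown below that the topology so obtained from epi-convergence is
  first countable, that its convergent sequences are exactly the epi-convergent ones
  (\<open>limitin_epi_topology\<close>), and that continuity on any subspace is sequential continuity
  (\<open>continuous_map_epi_topology\<close>).\<close>

definition epi_topology :: "('a::euclidean_space \<Rightarrow> ereal) topology" where
  "epi_topology = topology (\<lambda>U. U \<subseteq> Conv \<and>
     (\<forall>F f. range F \<subseteq> Conv \<and> f \<in> U \<and> epi_converges F f \<longrightarrow> (\<forall>\<^sub>F j in sequentially. F j \<in> U)))"


section \<open>Cones of convex functions\<close>

definition AO_cone ::
  "'a::euclidean_space set \<Rightarrow> 'a set \<Rightarrow> ('a \<Rightarrow> ereal) set \<Rightarrow> bool" where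
  "AO_cone \<A> \<O> \<Gamma> \<longleftrightarrow>
     \<Gamma> \<subseteq> Conv \<and>
     (\<forall>f\<in>\<Gamma>. \<forall>g\<in>\<Gamma>. (\<lambda>x. f x + g x) \<in> \<Gamma>) \<and>
     (\<forall>f\<in>\<Gamma>. \<forall>t>0. (\<lambda>x. ereal t * f x) \<in> \<Gamma>) \<and>
     (\<forall>f\<in>\<Gamma>. \<O> \<subseteq> edom f \<and> edom f \<subseteq> \<A>) \<and>
     convex_indicator \<A> \<in> \<Gamma> \<and> convex_indicator \<O> \<in> \<Gamma> \<and>
     (\<forall>K :: ('a \<times> real) set. K \<noteq> {} \<and> compact K \<and> convex K \<longrightarrow>
        (\<lambda>x. ereal (support_fun K (x, -1)) + convex_indicator \<A> x) \<in> \<Gamma>)"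


section \<open>Polynomial valuations\<close>

definition exponents_le :: "nat \<Rightarrow> ('a::euclidean_space \<Rightarrow> nat) set" where
  "exponents_le d = {\<alpha>. (\<forall>b. b \<notin> Basis \<longrightarrow> \<alpha> b = 0) \<and> (\<Sum>b\<in>Basis. \<alpha> b) \<le> d}"

definition polynomial_deg_le :: "nat \<Rightarrow> ('a::euclidean_space \<Rightarrow> 'v::real_vector) \<Rightarrow> bool" where
  "polynomial_deg_le d P \<longleftrightarrow>
     (\<exists>c. \<forall>x. P x = (\<Sum>\<alpha>\<in>exponents_le d. (\<Prod>b\<in>Basis. (x \<bullet> b) ^ \<alpha> b) *\<^sub>R c \<alpha>))"

definition valuation_on ::
  "('a \<Rightarrow> ereal) set \<Rightarrow> (('a \<Rightarrow> ereal) \<Rightarrow> 'v::ab_group_add) \<Rightarrow> bool" where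
  "valuation_on \<Gamma> Z \<longleftrightarrow>
     (\<forall>f h. f \<in> \<Gamma> \<and> h \<in> \<Gamma> \<and> (\<lambda>x. max (f x) (h x)) \<in> \<Gamma> \<and> (\<lambda>x. min (f x) (h x)) \<in> \<Gamma> \<longrightarrow>
        Z (\<lambda>x. max (f x) (h x)) + Z (\<lambda>x. min (f x) (h x)) = Z f + Z h)"

text \<open>An affine function \<open>\<lambda>x. a \<bullet> x + b\<close> is identified with the pair \<open>(a, b)\<close>.\<close>

definition polynomial_on ::
  "nat \<Rightarrow> ('a::euclidean_space \<Rightarrow> ereal) set \<Rightarrow> (('a \<Rightarrow> ereal) \<Rightarrow> 'v::real_vector) \<Rightarrow> bool" where
  "polynomial_on d \<Gamma> Z \<longleftrightarrow>
     (\<forall>f\<in>\<Gamma>. polynomial_deg_le d (\<lambda>(a, b::real). Z (\<lambda>x. f x + ereal (a \<bullet> x + b))))"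

text \<open>Maps \<open>\<Gamma> \<rightarrow> V\<close> are represented by functions that are \<^const>\<open>undefined\<close> off \<open>\<Gamma>\<close>.\<close>

definition PV ::
  "nat \<Rightarrow> ('a::euclidean_space \<Rightarrow> ereal) set \<Rightarrow> (('a \<Rightarrow> ereal) \<Rightarrow> 'v::real_tvs) set" where
  "PV d \<Gamma> = {Z \<in> extensional \<Gamma>.
     continuous_map (subtopology epi_topology \<Gamma>) euclidean Z \<and>
     valuation_on \<Gamma> Z \<and> polynomial_on d \<Gamma> Z}"

definition homogeneous_on ::
  "nat \<Rightarrow> ('a \<Rightarrow> ereal) set \<Rightarrow> (('a \<Rightarrow> ereal) \<Rightarrow> 'v::real_vector) \<Rightarrow> bool" where
  "homogeneous_on k \<Gamma> Z \<longleftrightarrow> (\<forall>t>0. \<forall>f\<in>\<Gamma>. Z (\<lambda>x. ereal t * f x) = t ^ k *\<^sub>R Z f)"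


section \<open>Adequacy of the definitions\<close>

lemma finite_exponents_le: "finite (exponents_le d :: ('a::euclidean_space \<Rightarrow> nat) set)"
proof -
  have "(exponents_le d :: ('a \<Rightarrow> nat) set) \<subseteq> (\<lambda>g b. if b \<in> Basis then g b else 0) ` (Basis \<rightarrow>\<^sub>E {..d})"
  proof
    fix \<alpha> :: "'a \<Rightarrow> nat" assume a: "\<alpha> \<in> exponents_le d"
    have "\<alpha> b \<le> d" if "b \<in> Basis" for b
      using a that member_le_sum[of b Basis \<alpha>] by (auto simp: exponents_le_def)
    then have "restrict \<alpha> Basis \<in> Basis \<rightarrow>\<^sub>E {..d}" by auto
    moreover have "\<alpha> = (\<lambda>b. if b \<in> Basis then restrict \<alpha> Basis b else 0)"
      using a by (auto simp: exponents_le_def)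
    ultimately show "\<alpha> \<in> (\<lambda>g b. if b \<in> Basis then g b else 0) ` (Basis \<rightarrow>\<^sub>E {..d})"
      by blast
  qed
  then show ?thesis
    by (rule finite_subset) (intro finite_imageI finite_PiE; simp)
qed

lemma openin_epi_topology:
  fixes U :: "('a::euclidean_space \<Rightarrow> ereal) set"
  shows "openin epi_topology U \<longleftrightarrow> U \<subseteq> Conv \<and>
     (\<forall>F f. range F \<subseteq> Conv \<and> f \<in> U \<and> epi_converges F f \<longrightarrow> (\<forall>\<^sub>F j in sequentially. F j \<in> U))"
proof -
  have "istopology (\<lambda>U :: ('a \<Rightarrow> ereal) set. U \<subseteq> Conv \<and>
     (\<forall>F f. range F \<subseteq> Conv \<and> f \<in> U \<and> epi_converges F f \<longrightarrow> (\<forall>\<^sub>F j in sequentially. F j \<in> U)))"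
    unfolding istopology_def
  proof (intro conjI allI impI)
    fix S T :: "('a \<Rightarrow> ereal) set" and F f
    assume S: "S \<subseteq> Conv \<and> (\<forall>F f. range F \<subseteq> Conv \<and> f \<in> S \<and> epi_converges F f \<longrightarrow> (\<forall>\<^sub>F j in sequentially. F j \<in> S))"
      and T: "T \<subseteq> Conv \<and> (\<forall>F f. range F \<subseteq> Conv \<and> f \<in> T \<and> epi_converges F f \<longrightarrow> (\<forall>\<^sub>F j in sequentially. F j \<in> T))"
    show "S \<inter> T \<subseteq> Conv" using S by blast
    assume "range F \<subseteq> Conv \<and> f \<in> S \<inter> T \<and> epi_converges F f"
    then have "\<forall>\<^sub>F j in sequentially. F j \<in> S" "\<forall>\<^sub>F j in sequentially. F j \<in> T"
      using S T by blast+
    then show "\<forall>\<^sub>F j in sequentially. F j \<in> S \<inter> T" by eventually_elim simp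
  next
    fix \<K> :: "('a \<Rightarrow> ereal) set set" and F f
    assume K: "\<forall>K\<in>\<K>. K \<subseteq> Conv \<and> (\<forall>F f. range F \<subseteq> Conv \<and> f \<in> K \<and> epi_converges F f \<longrightarrow> (\<forall>\<^sub>F j in sequentially. F j \<in> K))"
    show "\<Union>\<K> \<subseteq> Conv" using K by blast
    assume *: "range F \<subseteq> Conv \<and> f \<in> \<Union>\<K> \<and> epi_converges F f"
    then obtain K where "K \<in> \<K>" "f \<in> K" by blast
    then have "\<forall>\<^sub>F j in sequentially. F j \<in> K" using * K by blast
    then show "\<forall>\<^sub>F j in sequentially. F j \<in> \<Union>\<K>"
      by eventually_elim (use \<open>K \<in> \<K>\<close> in blast)
  qed
  then show ?thesis
    unfolding epi_topology_def by (simp add: topology_inverse')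
qed

lemma topspace_epi_topology [simp]: "topspace epi_topology = Conv"
proof (rule antisym)
  show "topspace epi_topology \<subseteq> Conv"
    using openin_topspace[of epi_topology] unfolding openin_epi_topology by (rule conjunct1)
  have "openin epi_topology Conv"
    by (auto simp: openin_epi_topology image_subset_iff)
  then show "Conv \<subseteq> topspace epi_topology"
    by (rule openin_subset)
qed

lemma openin_epi_hit:
  fixes c :: "'a::euclidean_space" and q :: real
  shows "openin epi_topology {f \<in> Conv. \<exists>x\<in>ball c r. f x < q}" (is "openin _ ?U")
  unfolding openin_epi_topology
proof (intro conjI allI impI)
  fix F and f :: "'a \<Rightarrow> ereal"
  assume *: "range F \<subseteq> Conv \<and> f \<in> ?U \<and> epi_converges F f"
  then obtain x where x: "x \<in> ball c r" "f x < q" by auto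
  obtain xs where xs: "xs \<longlonglongrightarrow> x" "(\<lambda>j. F j (xs j)) \<longlonglongrightarrow> f x"
    using * unfolding epi_converges_def by meson
  have "\<forall>\<^sub>F j in sequentially. xs j \<in> ball c r"
    using topological_tendstoD[OF xs(1) open_ball x(1)] .
  moreover have "\<forall>\<^sub>F j in sequentially. F j (xs j) < q"
    using order_tendstoD(2)[OF xs(2) x(2)] .
  ultimately show "\<forall>\<^sub>F j in sequentially. F j \<in> ?U"
    by eventually_elim (use * in blast)
qed auto

lemma epi_converges_subseq:
  fixes q :: real
  assumes "epi_converges F f" "f x > q" "strict_mono \<sigma>" "y \<longlonglongrightarrow> x"
  shows "\<forall>\<^sub>F n in sequentially. F (\<sigma> n) (y n) > q"
proof -
  define xs where "xs j = (if j \<in> range \<sigma> then y (inv \<sigma> j) else x)" for j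
  have inj: "inj \<sigma>" using assms(3) by (rule strict_mono_imp_inj_on)
  have xs\<sigma>: "xs (\<sigma> n) = y n" for n by (simp add: xs_def inj)
  have "xs \<longlonglongrightarrow> x"
  proof (rule topological_tendstoI)
    fix S assume S: "open S" "x \<in> S"
    then obtain N where N: "\<And>n. n \<ge> N \<Longrightarrow> y n \<in> S"
      using topological_tendstoD[OF assms(4)] unfolding eventually_sequentially by blast
    have "xs j \<in> S" if j: "j \<ge> \<sigma> N" for j
    proof (cases "j \<in> range \<sigma>")
      case True
      then obtain n where n: "j = \<sigma> n" by blast
      then have "n \<ge> N" using j assms(3) by (simp add: strict_mono_less_eq)
      then show ?thesis using N n xs\<sigma> by simp
    next
      case False
      then show ?thesis using S by (simp add: xs_def)
    qed
    then show "\<forall>\<^sub>F j in sequentially. xs j \<in> S"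
      unfolding eventually_sequentially by blast
  qed
  then have "f x \<le> liminf (\<lambda>j. F j (xs j))"
    using assms(1) unfolding epi_converges_def by blast
  then have "\<forall>\<^sub>F j in sequentially. F j (xs j) > q"
    using assms(2) by (simp add: le_Liminf_iff)
  then have "\<forall>\<^sub>F n in sequentially. F (\<sigma> n) (xs (\<sigma> n)) > q"
    using filterlim_subseq[OF assms(3)] by (rule eventually_compose_filterlim)
  then show ?thesis by (simp add: xs\<sigma>)
qed

lemma openin_epi_miss:
  fixes c :: "'a::euclidean_space" and q :: real
  shows "openin epi_topology {f \<in> Conv. \<forall>x\<in>cball c r. f x > q}" (is "openin _ ?U")
  unfolding openin_epi_topology
proof (intro conjI allI impI, blast, rule ccontr)
  fix F and f :: "'a \<Rightarrow> ereal"
  assume *: "range F \<subseteq> Conv \<and> f \<in> ?U \<and> epi_converges F f"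
    and "\<not> (\<forall>\<^sub>F j in sequentially. F j \<in> ?U)"
  then have inf: "infinite {j. F j \<notin> ?U}"
    by (simp add: cofinite_eq_sequentially[symmetric] eventually_cofinite)
  define \<sigma> where "\<sigma> = enumerate {j. F j \<notin> ?U}"
  have \<sigma>: "strict_mono \<sigma>" unfolding \<sigma>_def using inf by (rule strict_mono_enumerate)
  have "F (\<sigma> n) \<notin> ?U" for n
    using enumerate_in_set[OF inf, of n] by (simp add: \<sigma>_def)
  then have "\<exists>x\<in>cball c r. F (\<sigma> n) x \<le> q" for n
    using * by (auto simp: image_subset_iff not_less)
  then obtain y where y: "\<And>n. y n \<in> cball c r" "\<And>n. F (\<sigma> n) (y n) \<le> q" by metis
  obtain l s where l: "l \<in> cball c r" "strict_mono s" "(y \<circ> s) \<longlonglongrightarrow> l"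
    using compact_cball[of c r] y(1) unfolding compact_def by blast
  have "\<forall>\<^sub>F n in sequentially. F ((\<sigma> \<circ> s) n) ((y \<circ> s) n) > q"
    using * l(1) by (intro epi_converges_subseq[OF _ _ strict_mono_o[OF \<sigma> l(2)] l(3)]) auto
  then show False
    using y(2) by (auto simp: eventually_sequentially not_less[symmetric])
qed

lemma epi_convergesI:
  fixes f :: "'a::euclidean_space \<Rightarrow> ereal"
  assumes D: "\<And>X :: 'a set. open X \<Longrightarrow> X \<noteq> {} \<Longrightarrow> \<exists>d\<in>D. d \<in> X"
    and f: "f \<in> Conv"
    and hit: "\<And>c r q. c \<in> D \<Longrightarrow> r \<in> \<rat> \<Longrightarrow> q \<in> \<rat> \<Longrightarrow> \<exists>x\<in>ball c r. f x < ereal q \<Longrightarrow>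
                \<forall>\<^sub>F j in sequentially. \<exists>x\<in>ball c r. F j x < ereal q"
    and miss: "\<And>c r q. c \<in> D \<Longrightarrow> r \<in> \<rat> \<Longrightarrow> q \<in> \<rat> \<Longrightarrow> \<forall>x\<in>cball c r. f x > ereal q \<Longrightarrow>
                \<forall>\<^sub>F j in sequentially. \<forall>x\<in>cball c r. F j x > ereal q"
  shows "epi_converges F f"
proof -
  have rat_between: "\<exists>q\<in>\<rat>. a < ereal q \<and> ereal q < b" if ab: "a < b" for a b :: ereal
  proof -
    obtain u where u: "a < ereal u" "ereal u < b" using ereal_dense2[OF ab] by blast
    obtain v where v: "ereal u < ereal v" "ereal v < b" using ereal_dense2[OF u(2)] by blast
    then obtain q where q: "q \<in> \<rat>" "u < q" "q < v" using Rats_dense_in_real[of u v] by auto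
    moreover have "ereal q < b" using q v(2) by (intro less_trans[of "ereal q" "ereal v" b]) simp_all
    moreover have "a < ereal q" using q u(1) by (intro less_trans[of a "ereal u" "ereal q"]) simp_all
    ultimately show ?thesis using q(1) by blast
  qed
  have small_ball: "\<exists>c\<in>D. \<exists>r\<in>\<rat>. x \<in> ball c r \<and> cball c r \<subseteq> ball x e"
    if e: "e > 0" for x :: 'a and e :: real
  proof -
    obtain r where r: "r \<in> \<rat>" "0 < r" "r < e / 2"
      using Rats_dense_in_real[of 0 "e / 2"] e by auto
    obtain c where c: "c \<in> D" "c \<in> ball x r" using D[of "ball x r"] r by auto
    have "cball c r \<subseteq> ball x e"
    proof
      fix z assume "z \<in> cball c r"
      then have "dist x z < r + r"
        using c dist_triangle[of x z c] by (simp add: dist_commute)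
      then show "z \<in> ball x e" using r by simp
    qed
    then show ?thesis using r c by (auto simp: dist_commute)
  qed
  have liminf: "f x \<le> liminf (\<lambda>j. F j (xs j))" if xs: "xs \<longlonglongrightarrow> x" for x xs
    unfolding le_Liminf_iff
  proof (intro allI impI)
    fix u assume "u < f x"
    then obtain q where q: "q \<in> \<rat>" "u < ereal q" "ereal q < f x" using rat_between by blast
    have "f x \<le> Liminf (at x) f" using f by (simp add: Conv_def lower_semicont_def)
    then have "\<forall>\<^sub>F z in at x. f z > q" using q(3) by (simp add: le_Liminf_iff)
    then have "\<forall>\<^sub>F z in nhds x. f z > q" using q(3) by (simp add: eventually_nhds_conv_at)
    then obtain e where e: "e > 0" "\<And>z. dist z x < e \<Longrightarrow> f z > q"
      unfolding eventually_nhds_metric by blast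
    obtain c r where c: "c \<in> D" "r \<in> \<rat>" "x \<in> ball c r" "cball c r \<subseteq> ball x e"
      using small_ball[OF e(1)] by blast
    have "\<forall>z\<in>cball c r. f z > q" using c e(2) by (auto simp: dist_commute subset_iff)
    then have "\<forall>\<^sub>F j in sequentially. \<forall>z\<in>cball c r. F j z > q"
      using miss c q by blast
    moreover have "\<forall>\<^sub>F j in sequentially. xs j \<in> ball c r"
      using topological_tendstoD[OF xs open_ball c(3)] .
    ultimately show "\<forall>\<^sub>F j in sequentially. u < F j (xs j)"
      by eventually_elim (use q(2) in \<open>auto intro: less_trans\<close>)
  qed
  moreover have "\<exists>xs. xs \<longlonglongrightarrow> x \<and> (\<lambda>j. F j (xs j)) \<longlonglongrightarrow> f x" for x
  proof (cases "f x = \<infinity>")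
    case True
    have "(\<lambda>j. F j x) \<longlonglongrightarrow> f x"
      using liminf[of "\<lambda>_. x" x] True
      by (auto simp: le_Liminf_iff intro!: order_tendstoI)
    then show ?thesis by (intro exI[of _ "\<lambda>_. x"]) simp
  next
    case False
    then obtain a where a: "f x = ereal a" using f by (cases "f x") (auto simp: Conv_def)
    define G where "G j = {e::real. e > 0 \<and> (\<exists>y. dist x y < e \<and> F j y < ereal (a + e))}" for j
    have ev: "\<forall>\<^sub>F j in sequentially. e \<in> G j" if e: "e > 0" for e
    proof -
      obtain q where q: "q \<in> \<rat>" "f x < ereal q" "ereal q < ereal (a + e)"
        using rat_between[of "f x" "ereal (a + e)"] e a by auto
      obtain c r where c: "c \<in> D" "r \<in> \<rat>" "x \<in> ball c r" "cball c r \<subseteq> ball x e"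
        using small_ball[OF e] by blast
      have "\<forall>\<^sub>F j in sequentially. \<exists>z\<in>ball c r. F j z < ereal q"
        using hit c q by blast
      then show ?thesis
      proof eventually_elim
        case (elim j)
        then obtain z where z: "z \<in> ball c r" "F j z < ereal q" by blast
        then have "dist x z < e" using c(4) by (auto simp: subset_iff)
        moreover have "F j z < ereal (a + e)" using z q by (auto intro: less_trans)
        ultimately show ?case using e by (auto simp: G_def)
      qed
    qed
    have "\<exists>y. G j \<noteq> {} \<longrightarrow> dist x y < Inf (G j) + 1 / Suc j \<and>
                 F j y < ereal (a + (Inf (G j) + 1 / Suc j))" for j
    proof (cases "G j = {}")
      case nonempty: False
      then obtain e where e: "e \<in> G j" "e < Inf (G j) + 1 / Suc j"
        using cInf_lessD[of "G j" "Inf (G j) + 1 / Suc j"] by auto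
      then obtain y where y: "dist x y < e" "F j y < ereal (a + e)" by (auto simp: G_def)
      have "ereal (a + e) \<le> ereal (a + (Inf (G j) + 1 / Suc j))" using e by simp
      then have "F j y < ereal (a + (Inf (G j) + 1 / Suc j))" using y(2) by (rule less_le_trans[rotated])
      then show ?thesis using y e by (intro exI[of _ y]) auto
    qed simp
    then obtain xs where xs: "\<And>j. G j \<noteq> {} \<Longrightarrow> dist x (xs j) < Inf (G j) + 1 / Suc j"
      "\<And>j. G j \<noteq> {} \<Longrightarrow> F j (xs j) < ereal (a + (Inf (G j) + 1 / Suc j))" by metis
    have close: "\<forall>\<^sub>F j in sequentially. dist x (xs j) < e \<and> F j (xs j) < ereal (a + e)"
      if e: "e > 0" for e
    proof -
      have "\<forall>\<^sub>F j in sequentially. 1 / real (Suc j) < e / 2"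
        using order_tendstoD(2)[OF LIMSEQ_inverse_real_of_nat, of "e / 2"] e
        by (simp add: inverse_eq_divide)
      moreover have "\<forall>\<^sub>F j in sequentially. e / 2 \<in> G j" using ev e by simp
      ultimately show ?thesis
      proof eventually_elim
        case (elim j)
        have "bdd_below (G j)" by (rule bdd_belowI[of _ 0]) (auto simp: G_def)
        then have "Inf (G j) \<le> e / 2" using elim(2) by (intro cInf_lower)
        then have le: "Inf (G j) + 1 / Suc j \<le> e" using elim(1) by linarith
        have "G j \<noteq> {}" using elim(2) by blast
        then have "dist x (xs j) < Inf (G j) + 1 / Suc j"
          "F j (xs j) < ereal (a + (Inf (G j) + 1 / Suc j))" using xs by blast+
        moreover have "ereal (a + (Inf (G j) + 1 / Suc j)) \<le> ereal (a + e)" using le by simp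
        ultimately show ?case using le by (meson less_le_trans)
      qed
    qed
    have lim: "xs \<longlonglongrightarrow> x"
      unfolding tendsto_iff
    proof (intro allI impI)
      fix e :: real assume "e > 0"
      from close[OF this] show "\<forall>\<^sub>F j in sequentially. dist (xs j) x < e"
        by eventually_elim (simp add: dist_commute)
    qed
    moreover have "(\<lambda>j. F j (xs j)) \<longlonglongrightarrow> f x"
    proof (rule order_tendstoI)
      fix u assume "u < f x"
      then show "\<forall>\<^sub>F j in sequentially. u < F j (xs j)"
        using liminf[OF lim] by (simp add: le_Liminf_iff)
    next
      fix u assume "f x < u"
      then obtain q where q: "f x < ereal q" "ereal q < u" using ereal_dense2 by blast
      then have "q - a > 0" using a by simp
      from close[OF this] show "\<forall>\<^sub>F j in sequentially. F j (xs j) < u"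
        by eventually_elim (use q(2) in \<open>auto intro: less_trans\<close>)
    qed
    ultimately show ?thesis by blast
  qed
  ultimately show ?thesis unfolding epi_converges_def by blast
qed

theorem limitin_epi_topology:
  assumes "range F \<subseteq> Conv" "f \<in> Conv"
  shows "limitin epi_topology F f sequentially \<longleftrightarrow> epi_converges F f"
proof
  assume "epi_converges F f"
  then show "limitin epi_topology F f sequentially"
    using assms by (auto simp: limitin_def openin_epi_topology)
next
  assume lim: "limitin epi_topology F f sequentially"
  have ev: "\<forall>\<^sub>F j in sequentially. F j \<in> U" if "openin epi_topology U" "f \<in> U" for U
    using lim that by (auto simp: limitin_def)
  show "epi_converges F f"
  proof (rule epi_convergesI[where D = UNIV])
    fix c r q assume "\<exists>x\<in>ball c r. f x < ereal q"
    then have "\<forall>\<^sub>F j in sequentially. F j \<in> {f \<in> Conv. \<exists>x\<in>ball c r. f x < ereal q}"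
      using assms by (intro ev openin_epi_hit) auto
    then show "\<forall>\<^sub>F j in sequentially. \<exists>x\<in>ball c r. F j x < ereal q"
      by eventually_elim simp
  next
    fix c r q assume "\<forall>x\<in>cball c r. f x > ereal q"
    then have "\<forall>\<^sub>F j in sequentially. F j \<in> {f \<in> Conv. \<forall>x\<in>cball c r. f x > ereal q}"
      using assms by (intro ev openin_epi_miss) auto
    then show "\<forall>\<^sub>F j in sequentially. \<forall>x\<in>cball c r. F j x > ereal q"
      by eventually_elim simp
  qed (use assms in auto)
qed

lemma epi_countable_nbhd_base:
  fixes f :: "'a::euclidean_space \<Rightarrow> ereal"
  assumes f: "f \<in> Conv"
  obtains N where "\<And>n::nat. openin epi_topology (N n)" "\<And>n. f \<in> N n"
    "\<And>F. (\<And>n. F n \<in> N n) \<Longrightarrow> epi_converges F f"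
proof -
  obtain D :: "'a set" where D: "countable D" "\<And>X :: 'a set. open X \<Longrightarrow> X \<noteq> {} \<Longrightarrow> \<exists>d\<in>D. d \<in> X"
    using countable_dense_setE by blast
  define hitset where
    "hitset p = (case p of (c :: 'a, r, q) \<Rightarrow> {g \<in> Conv. \<exists>x\<in>ball c r. g x < ereal q})" for p
  define missset where
    "missset p = (case p of (c :: 'a, r, q) \<Rightarrow> {g \<in> Conv. \<forall>x\<in>cball c r. g x > ereal q})" for p
  define S where "S = insert Conv {s \<in> hitset ` (D \<times> \<rat> \<times> \<rat>) \<union> missset ` (D \<times> \<rat> \<times> \<rat>). f \<in> s}"
  have "countable (hitset ` (D \<times> \<rat> \<times> \<rat>) \<union> missset ` (D \<times> \<rat> \<times> \<rat>))"
    using D(1) by (intro countable_Un countable_image countable_SIGMA countable_rat)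
  then have "countable {s \<in> hitset ` (D \<times> \<rat> \<times> \<rat>) \<union> missset ` (D \<times> \<rat> \<times> \<rat>). f \<in> s}"
    by (rule countable_subset[rotated]) blast
  then have S: "countable S" "S \<noteq> {}"
    unfolding S_def by simp_all
  have openS: "openin epi_topology s" if "s \<in> S" for s
  proof -
    have "openin epi_topology (Conv :: ('a \<Rightarrow> ereal) set)"
      using openin_topspace[of "epi_topology :: ('a \<Rightarrow> ereal) topology"] by simp
    then show ?thesis
      using that openin_epi_hit openin_epi_miss
      by (auto simp: S_def hitset_def missset_def)
  qed
  have fS: "f \<in> s" if "s \<in> S" for s using that f by (auto simp: S_def)
  define N where "N n = (\<Inter>i\<le>n. from_nat_into S i)" for n
  show thesis
  proof
    show "openin epi_topology (N n)" for n
      unfolding N_def by (intro openin_INT2) (auto intro!: openS from_nat_into S)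
    show "f \<in> N n" for n
      unfolding N_def by (auto intro!: fS from_nat_into S)
    fix F assume F: "\<And>n. F n \<in> N n"
    have ev: "\<forall>\<^sub>F j in sequentially. F j \<in> s" if s: "s \<in> S" for s
    proof -
      obtain i where i: "s = from_nat_into S i"
        using from_nat_into_surj[OF S(1) s] by blast
      have "F j \<in> s" if "j \<ge> i" for j
        using F[of j] that i by (auto simp: N_def)
      then show ?thesis unfolding eventually_sequentially by blast
    qed
    show "epi_converges F f"
    proof (rule epi_convergesI[OF D(2) f])
      fix c r q assume *: "c \<in> D" "r \<in> \<rat>" "q \<in> \<rat>" "\<exists>x\<in>ball c r. f x < ereal q"
      have "hitset (c, r, q) \<in> hitset ` (D \<times> \<rat> \<times> \<rat>)"
        using * by (intro imageI) simp
      moreover have "f \<in> hitset (c, r, q)" using * f by (simp add: hitset_def)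
      ultimately have "\<forall>\<^sub>F j in sequentially. F j \<in> hitset (c, r, q)"
        by (intro ev) (simp add: S_def)
      then show "\<forall>\<^sub>F j in sequentially. \<exists>x\<in>ball c r. F j x < ereal q"
        by eventually_elim (simp add: hitset_def)
    next
      fix c r q assume *: "c \<in> D" "r \<in> \<rat>" "q \<in> \<rat>" "\<forall>x\<in>cball c r. f x > ereal q"
      have "missset (c, r, q) \<in> missset ` (D \<times> \<rat> \<times> \<rat>)"
        using * by (intro imageI) simp
      moreover have "f \<in> missset (c, r, q)" using * f by (simp add: missset_def)
      ultimately have "\<forall>\<^sub>F j in sequentially. F j \<in> missset (c, r, q)"
        by (intro ev) (simp add: S_def)
      then show "\<forall>\<^sub>F j in sequentially. \<forall>x\<in>cball c r. F j x > ereal q"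
        by eventually_elim (simp add: missset_def)
    qed auto
  qed
qed

lemma epi_nbhd_base_subset:
  assumes N: "\<And>n::nat. f \<in> N n" "\<And>F. (\<And>n. F n \<in> N n) \<Longrightarrow> epi_converges F f"
    and NConv: "\<And>n. N n \<subseteq> Conv" and U: "openin epi_topology U" "f \<in> U"
  shows "\<exists>n. N n \<subseteq> U"
proof (rule ccontr)
  assume "\<nexists>n. N n \<subseteq> U"
  then have "\<forall>n. \<exists>g. g \<in> N n \<and> g \<notin> U" by blast
  then obtain F where F: "\<And>n. F n \<in> N n" "\<And>n. F n \<notin> U" by metis
  then have "epi_converges F f" "range F \<subseteq> Conv" using N NConv by blast+
  then have "\<forall>\<^sub>F j in sequentially. F j \<in> U"
    using U by (auto simp: openin_epi_topology)
  then show False using F(2) by simp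
qed

theorem first_countable_epi_topology:
  "first_countable (epi_topology :: ('a::euclidean_space \<Rightarrow> ereal) topology)"
  unfolding first_countable_def
proof
  fix f :: "'a \<Rightarrow> ereal" assume "f \<in> topspace epi_topology"
  then have "f \<in> Conv" by simp
  then obtain N where N: "\<And>n::nat. openin epi_topology (N n)" "\<And>n. f \<in> N n"
    "\<And>F. (\<And>n. F n \<in> N n) \<Longrightarrow> epi_converges F f"
    using epi_countable_nbhd_base by blast
  have NConv: "N n \<subseteq> Conv" for n using openin_subset[OF N(1)] by simp
  have "\<exists>n. N n \<subseteq> U" if "openin epi_topology U" "f \<in> U" for U
    using epi_nbhd_base_subset[of f N U] N(2,3) NConv that by blast
  then show "\<exists>\<B>. countable \<B> \<and> (\<forall>V\<in>\<B>. openin epi_topology V) \<and>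
      (\<forall>U. openin epi_topology U \<and> f \<in> U \<longrightarrow> (\<exists>V\<in>\<B>. f \<in> V \<and> V \<subseteq> U))"
    using N by (intro exI[of _ "range N"]) auto
qed

theorem continuous_map_epi_topology:
  fixes Z :: "('a::euclidean_space \<Rightarrow> ereal) \<Rightarrow> 'v::topological_space"
  assumes \<Gamma>: "\<Gamma> \<subseteq> Conv"
  shows "continuous_map (subtopology epi_topology \<Gamma>) euclidean Z \<longleftrightarrow>
    (\<forall>F f. range F \<subseteq> \<Gamma> \<and> f \<in> \<Gamma> \<and> epi_converges F f \<longrightarrow> (\<lambda>j. Z (F j)) \<longlonglongrightarrow> Z f)"
    (is "?L \<longleftrightarrow> ?R")
proof
  assume L: ?L
  show ?R
  proof (intro allI impI)
    fix F f assume *: "range F \<subseteq> \<Gamma> \<and> f \<in> \<Gamma> \<and> epi_converges F f"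
    then have "range F \<subseteq> Conv" "f \<in> Conv" using \<Gamma> by blast+
    then have "limitin epi_topology F f sequentially"
      using * limitin_epi_topology by blast
    then have "limitin (subtopology epi_topology \<Gamma>) F f sequentially"
      using * by (auto simp: limitin_subtopology image_subset_iff)
    then have "limitin euclidean (Z \<circ> F) (Z f) sequentially"
      by (rule continuous_map_limit[OF L])
    then show "(\<lambda>j. Z (F j)) \<longlonglongrightarrow> Z f" by (simp add: o_def)
  qed
next
  assume R: ?R
  have "openin (subtopology epi_topology \<Gamma>) {f \<in> \<Gamma>. Z f \<in> W}" if W: "open W" for W
  proof (subst openin_subopen, intro ballI)
    fix f assume f: "f \<in> {f \<in> \<Gamma>. Z f \<in> W}"
    then have "f \<in> Conv" using \<Gamma> by blast
    then obtain N where N: "\<And>n::nat. openin epi_topology (N n)" "\<And>n. f \<in> N n"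
      "\<And>F. (\<And>n. F n \<in> N n) \<Longrightarrow> epi_converges F f"
      using epi_countable_nbhd_base by blast
    have "\<exists>n. N n \<inter> \<Gamma> \<subseteq> {f \<in> \<Gamma>. Z f \<in> W}"
    proof (rule ccontr)
      assume "\<nexists>n. N n \<inter> \<Gamma> \<subseteq> {f \<in> \<Gamma>. Z f \<in> W}"
      then have "\<forall>n. \<exists>g. g \<in> N n \<and> g \<in> \<Gamma> \<and> Z g \<notin> W" by blast
      then obtain F where F: "\<And>n. F n \<in> N n" "\<And>n. F n \<in> \<Gamma>" "\<And>n. Z (F n) \<notin> W" by metis
      then have "(\<lambda>j. Z (F j)) \<longlonglongrightarrow> Z f" using R N(3) f by blast
      then have "\<forall>\<^sub>F j in sequentially. Z (F j) \<in> W"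
        using W f by (intro topological_tendstoD) auto
      then show False using F(3) by simp
    qed
    then obtain n where n: "N n \<inter> \<Gamma> \<subseteq> {f \<in> \<Gamma>. Z f \<in> W}" by blast
    show "\<exists>T. openin (subtopology epi_topology \<Gamma>) T \<and> f \<in> T \<and> T \<subseteq> {f \<in> \<Gamma>. Z f \<in> W}"
      using n N f by (intro exI[of _ "N n \<inter> \<Gamma>"]) (auto simp: openin_subtopology)
  qed
  moreover have "topspace (subtopology epi_topology \<Gamma>) = \<Gamma>" using \<Gamma> by auto
  ultimately show ?L by (simp add: continuous_map)
qed

end

theory Submission
  imports Defs
begin

text \<open>
  Let \<open>Y F = Z (F + I\<^bsub>\<A>\<^esub>)\<close> for maxima \<open>F\<close> of finitely many affine functions. If
  \<open>B = max \<ell> B'\<close> with \<open>\<ell>\<close> affine, the valuation property gives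
  \<open>Y (g + (m + 1) B) = Y (g + \<ell> + m B) + Y (g + B + m B') - Y (g + \<ell> + m B')\<close>. Since
  \<open>F \<mapsto> Y (F + \<ell>) - Y F\<close> has translation degree one less than \<open>Y\<close>, double induction shows that
  \<open>m \<mapsto> Y (g + m B)\<close> is polynomial of degree at most \<open>k + d\<close> when \<open>B\<close> is a maximum of \<open>k + 1\<close>
  affine functions. More than \<open>n + 1\<close> affine functions have affinely dependent gradients, and
  subdividing edges (the valuation property once more) expresses \<open>Y\<close> through maxima of fewer
  functions, so that the degree is at most \<open>n + d\<close>. Such maxima, restricted to \<open>\<A>\<close>, are dense in
  \<open>\<Gamma>\<close>, hence \<open>t \<mapsto> Z (t f)\<close> is polynomial of degree at most \<open>n + d\<close> for all \<open>f\<close>; its coefficients,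
  extracted by Lagrange interpolation at \<open>1, \<dots>, n + d + 1\<close>, are the homogeneous components.
\<close>

section \<open>Finite differences\<close>

text \<open>The \<open>N\<close>-th forward difference vanishes, so the sequence is polynomial of
  degree below \<open>N\<close>. The strict bound gives the zero sequence a place, at
  \<open>N = 0\<close>, from which the inductions start.\<close>

primrec seq_deg_less :: "nat \<Rightarrow> (nat \<Rightarrow> 'v::ab_group_add) \<Rightarrow> bool" where
  "seq_deg_less 0 D \<longleftrightarrow> (\<forall>m. D m = 0)"
| "seq_deg_less (Suc N) D \<longleftrightarrow> seq_deg_less N (\<lambda>m. D (Suc m) - D m)"

lemma seq_deg_less_zero: "seq_deg_less N (\<lambda>m. 0)"
  by (induction N) auto

lemma seq_deg_less_add:
  "seq_deg_less N D \<Longrightarrow> seq_deg_less N E \<Longrightarrow> seq_deg_less N (\<lambda>m. D m + E m)"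
proof (induction N arbitrary: D E)
  case (Suc N)
  from Suc.IH[of "\<lambda>m. D (Suc m) - D m" "\<lambda>m. E (Suc m) - E m"] Suc.prems
  show ?case by (simp add: algebra_simps)
qed simp

lemma seq_deg_less_diff:
  "seq_deg_less N D \<Longrightarrow> seq_deg_less N E \<Longrightarrow> seq_deg_less N (\<lambda>m. D m - E m)"
proof (induction N arbitrary: D E)
  case (Suc N)
  from Suc.IH[of "\<lambda>m. D (Suc m) - D m" "\<lambda>m. E (Suc m) - E m"] Suc.prems
  show ?case by (simp add: algebra_simps)
qed simp

lemma seq_deg_less_Suc: "seq_deg_less N D \<Longrightarrow> seq_deg_less (Suc N) D"
proof (induction N arbitrary: D)
  case (Suc N)
  from Suc.IH[of "\<lambda>m. D (Suc m) - D m"] Suc.prems show ?case by simp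
qed simp

lemma seq_deg_less_mono: "seq_deg_less M D \<Longrightarrow> M \<le> N \<Longrightarrow> seq_deg_less N D"
  by (induction N) (auto simp: le_Suc_eq seq_deg_less_Suc simp del: seq_deg_less.simps)

section \<open>Newton expansion and extraction of coefficients\<close>

lemma seq_deg_less_binomial:
  fixes D :: "nat \<Rightarrow> 'v::real_vector"
  shows "seq_deg_less N D \<Longrightarrow> \<exists>c. \<forall>m. D m = (\<Sum>i<N. real (m choose i) *\<^sub>R c i)"
proof (induction N arbitrary: D)
  case (Suc N)
  from Suc.prems have "seq_deg_less N (\<lambda>m. D (Suc m) - D m)" by simp
  from Suc.IH[OF this] obtain c
    where c: "\<And>m. D (Suc m) - D m = (\<Sum>i<N. real (m choose i) *\<^sub>R c i)" by metis
  \<comment> \<open>Newton's forward difference formula: summing the differences turns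
    \<open>m choose i\<close> into \<open>m choose Suc i\<close> by Pascal's rule.\<close>
  have *: "D m = D 0 + (\<Sum>i<N. real (m choose Suc i) *\<^sub>R c i)" for m
  proof (induction m)
    case (Suc m)
    have "D (Suc m) = D m + (\<Sum>i<N. real (m choose i) *\<^sub>R c i)"
      using c[of m] by (simp add: diff_eq_eq)
    also have "\<dots> = D 0 + (\<Sum>i<N. real (Suc m choose Suc i) *\<^sub>R c i)"
      by (subst Suc) (simp add: sum.distrib scaleR_add_left add_ac)
    finally show ?case .
  qed simp
  have "D m = (\<Sum>i<Suc N. real (m choose i) *\<^sub>R (case i of 0 \<Rightarrow> D 0 | Suc j \<Rightarrow> c j))" for m
    by (subst sum.lessThan_Suc_shift) (simp add: *[of m])
  then show ?case by blast
qed simp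

lemma binomial_poly:
  obtains p :: "real poly" where "degree p \<le> i" "\<And>m. poly p (real m) = real (m choose i)"
proof
  let ?p = "smult (1 / fact i) (\<Prod>j = 0..<i. [:- real j, 1:])"
  have "degree (\<Prod>j = 0..<i. [:- real j, 1:]) \<le> (\<Sum>j = 0..<i. degree [:- real j, 1:])"
    by (intro degree_prod_sum_le[unfolded o_def]) auto
  then show "degree ?p \<le> i" by simp
  show "poly ?p (real m) = real (m choose i)" for m
    by (simp add: binomial_gbinomial gbinomial_prod_rev poly_prod)
qed

text \<open>Each binomial coefficient is a real polynomial in \<open>m\<close> of degree at most
  \<open>i\<close>; expanding them and collecting equal powers turns the Newton form into the
  monomial form.\<close>

lemma seq_deg_less_powers:
  fixes D :: "nat \<Rightarrow> 'v::real_vector"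
  assumes "seq_deg_less N D"
  obtains c where "\<And>m. D m = (\<Sum>k<N. real m ^ k *\<^sub>R c k)"
proof -
  obtain b where b: "\<And>m. D m = (\<Sum>i<N. real (m choose i) *\<^sub>R b i)"
    using seq_deg_less_binomial[OF assms] by metis
  have "\<exists>p :: real poly. degree p \<le> i \<and> (\<forall>m. poly p (real m) = real (m choose i))" for i
    using binomial_poly by metis
  then obtain p :: "nat \<Rightarrow> real poly" where p: "\<And>i. degree (p i) \<le> i"
    "\<And>i m. poly (p i) (real m) = real (m choose i)" by metis
  have choose: "real (m choose i) = (\<Sum>k<N. coeff (p i) k * real m ^ k)" if "i < N" for i m
  proof -
    have "(\<Sum>k\<le>degree (p i). coeff (p i) k * real m ^ k) = (\<Sum>k<N. coeff (p i) k * real m ^ k)"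
      using p(1)[of i] that by (intro sum.mono_neutral_left) (auto simp: coeff_eq_0)
    then show ?thesis using p(2)[of i m] by (simp add: poly_altdef)
  qed
  show thesis
  proof (rule that[of "\<lambda>k. \<Sum>i<N. coeff (p i) k *\<^sub>R b i"])
    fix m
    have "D m = (\<Sum>i<N. \<Sum>k<N. (coeff (p i) k * real m ^ k) *\<^sub>R b i)"
      unfolding b by (intro sum.cong) (simp_all add: choose scaleR_sum_left)
    also have "\<dots> = (\<Sum>k<N. real m ^ k *\<^sub>R (\<Sum>i<N. coeff (p i) k *\<^sub>R b i))"
      by (subst sum.swap) (simp add: scaleR_sum_right mult.commute)
    finally show "D m = (\<Sum>k<N. real m ^ k *\<^sub>R (\<Sum>i<N. coeff (p i) k *\<^sub>R b i))" .
  qed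
qed

text \<open>\<open>w k i\<close> is the coefficient of degree \<open>k\<close> in the Lagrange basis
  polynomial of the node \<open>i\<close> among 1, ..., \<open>Suc N\<close>. Interpolation at these
  nodes reproduces every monomial of degree at most \<open>N\<close>. The nodes start at 1 because a
  cone offers only positive multiples of its elements.\<close>

lemma Lagrange_weights:
  obtains w :: "nat \<Rightarrow> nat \<Rightarrow> real" where
    "\<And>k l. l \<le> N \<Longrightarrow> (\<Sum>i = 1..Suc N. w k i * real i ^ l) = (if k = l then 1 else 0)"
proof -
  define L :: "nat \<Rightarrow> real poly" where
    "L i = smult (1 / (\<Prod>j\<in>{1..Suc N} - {i}. real i - real j)) (\<Prod>j\<in>{1..Suc N} - {i}. [:- real j, 1:])" for i
  have deg: "degree (L i) \<le> N" if "i \<in> {1..Suc N}" for i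
  proof -
    have "degree (\<Prod>j\<in>{1..Suc N} - {i}. [:- real j, 1:]) \<le> (\<Sum>j\<in>{1..Suc N} - {i}. degree [:- real j, 1:])"
      by (intro degree_prod_sum_le[unfolded o_def]) auto
    also have "\<dots> = N" using that by simp
    finally show ?thesis by (simp add: L_def)
  qed
  have val: "poly (L i) (real m) = (if i = m then 1 else 0)"
    if "i \<in> {1..Suc N}" "m \<in> {1..Suc N}" for i m
    using that by (auto simp: L_def poly_prod)
  show thesis
  proof (rule that[of "\<lambda>k i. coeff (L i) k"])
    fix k l assume l: "l \<le> N"
    have "(\<Sum>i = 1..Suc N. smult (real i ^ l) (L i)) = monom 1 l"
    proof (rule poly_eqI_degree[where A = "real ` {1..Suc N}"])
      fix x assume "x \<in> real ` {1..Suc N}"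
      then obtain m where m: "m \<in> {1..Suc N}" "x = real m" by blast
      have "poly (\<Sum>i = 1..Suc N. smult (real i ^ l) (L i)) x = (\<Sum>i = 1..Suc N. real i ^ l * (if i = m then 1 else 0))"
        unfolding poly_sum m(2) poly_smult by (intro sum.cong refl) (use val m(1) in simp)
      also have "\<dots> = real m ^ l"
        using m(1) by (simp add: if_distrib[of "\<lambda>x. _ * x"] sum.delta cong: if_cong)
      finally show "poly (\<Sum>i = 1..Suc N. smult (real i ^ l) (L i)) x = poly (monom 1 l) x"
        by (simp add: m(2) poly_monom)
    next
      have "card (real ` {1..Suc N}) = Suc N" by (subst card_image) (auto intro: inj_onI)
      moreover have "degree (\<Sum>i = 1..Suc N. smult (real i ^ l) (L i)) \<le> N"
        by (intro degree_sum_le) (use deg in \<open>auto intro: order_trans[OF degree_smult_le]\<close>)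
      ultimately show "card (real ` {1..Suc N}) > degree (\<Sum>i = 1..Suc N. smult (real i ^ l) (L i))"
        "card (real ` {1..Suc N}) > degree (monom (1::real) l)"
        using l by (auto simp: degree_monom_eq)
    qed
    from arg_cong[OF this, of "\<lambda>p. coeff p k"]
    show "(\<Sum>i = 1..Suc N. coeff (L i) k * real i ^ l) = (if k = l then 1 else 0)"
      by (auto simp: coeff_sum mult.commute)
  qed
qed

section \<open>Polynomial maps through iterated differences\<close>

text \<open>Unlike an expansion into monomials, this form refers to translations only, so it carries
  over to functionals on functions that are translated by affine ones.\<close>

primrec diff_deg_less :: "nat \<Rightarrow> ('a::ab_group_add \<Rightarrow> 'v::ab_group_add) \<Rightarrow> bool" where
  "diff_deg_less 0 P \<longleftrightarrow> (\<forall>x. P x = 0)"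
| "diff_deg_less (Suc e) P \<longleftrightarrow> (\<forall>h. diff_deg_less e (\<lambda>x. P (x + h) - P x))"

lemma diff_deg_less_zero: "diff_deg_less e (\<lambda>x. 0)"
  by (induction e) auto

lemma diff_deg_less_add:
  "diff_deg_less e P \<Longrightarrow> diff_deg_less e Q \<Longrightarrow> diff_deg_less e (\<lambda>x. P x + Q x)"
proof (induction e arbitrary: P Q)
  case (Suc e)
  have "diff_deg_less e (\<lambda>x. P (x + h) - P x + (Q (x + h) - Q x))" for h
    using Suc.prems by (intro Suc.IH) auto
  then show ?case by (simp add: algebra_simps)
qed simp

lemma diff_deg_less_sum:
  "(\<And>i. i \<in> I \<Longrightarrow> diff_deg_less e (P i)) \<Longrightarrow> diff_deg_less e (\<lambda>x. \<Sum>i\<in>I. P i x)"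
  by (induction I rule: infinite_finite_induct) (auto intro: diff_deg_less_add diff_deg_less_zero)

lemma diff_deg_less_shift: "diff_deg_less e P \<Longrightarrow> diff_deg_less e (\<lambda>x. P (x + h))"
proof (induction e arbitrary: P)
  case (Suc e)
  have "diff_deg_less e (\<lambda>x. (\<lambda>x. P (x + h') - P x) (x + h))" for h'
    using Suc.prems by (intro Suc.IH) simp
  then show ?case by (simp add: algebra_simps)
qed simp

lemma diff_deg_less_Suc: "diff_deg_less e P \<Longrightarrow> diff_deg_less (Suc e) P"
proof (induction e arbitrary: P)
  case (Suc e)
  have "diff_deg_less (Suc e) (\<lambda>x. P (x + h) - P x)" for h
    using Suc.prems by (intro Suc.IH) simp
  then show ?case by (subst diff_deg_less.simps) blast
qed simp

lemma diff_deg_less_mono: "diff_deg_less M P \<Longrightarrow> M \<le> N \<Longrightarrow> diff_deg_less N P"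
  by (induction N) (auto simp: le_Suc_eq diff_deg_less_Suc simp del: diff_deg_less.simps)

text \<open>Discrete product rule: the difference of \<open>p * P\<close> is \<open>p\<close> times
  the difference of \<open>P\<close>, plus the constant \<open>p h\<close> times a shift of
  \<open>P\<close>. The induction hypothesis bounds the first term and the assumption on
  \<open>P\<close> the second.\<close>

lemma diff_deg_less_mult_linear:
  fixes P :: "'a::real_vector \<Rightarrow> 'v::real_vector"
  assumes p: "linear p"
  shows "diff_deg_less e P \<Longrightarrow> diff_deg_less (Suc e) (\<lambda>x. p x *\<^sub>R P x)"
proof (induction e arbitrary: P)
  case (Suc e)
  have scale: "diff_deg_less e (\<lambda>x. c *\<^sub>R Q x)" if "diff_deg_less e Q" for e c and Q :: "'a \<Rightarrow> 'v"
    using that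
  proof (induction e arbitrary: Q)
    case (Suc e)
    have "diff_deg_less e (\<lambda>x. c *\<^sub>R (Q (x + h) - Q x))" for h
      using Suc.prems by (intro Suc.IH) simp
    then show ?case by (simp add: algebra_simps)
  qed simp
  have "diff_deg_less (Suc e) (\<lambda>x. p x *\<^sub>R (P (x + h) - P x) + p h *\<^sub>R P (x + h))" for h
    by (intro diff_deg_less_add scale diff_deg_less_shift Suc.prems Suc.IH)
       (use Suc.prems in simp)
  moreover have "p (x + h) *\<^sub>R P (x + h) - p x *\<^sub>R P x
      = p x *\<^sub>R (P (x + h) - P x) + p h *\<^sub>R P (x + h)" for x h
    by (simp add: linear_add[OF p] algebra_simps)
  ultimately show ?case by (subst diff_deg_less.simps) simp
qed simp

lemma diff_deg_less_power:
  fixes P :: "'a::real_vector \<Rightarrow> 'v::real_vector"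
  assumes p: "linear p" and "diff_deg_less e P"
  shows "diff_deg_less (e + k) (\<lambda>x. p x ^ k *\<^sub>R P x)"
proof (induction k)
  case (Suc k)
  from diff_deg_less_mult_linear[OF p Suc] show ?case by simp
qed (use assms in simp)

lemma diff_deg_less_monomial:
  fixes c :: "'v::real_vector" and \<alpha> :: "'a::real_inner \<Rightarrow> nat"
  assumes "finite B"
  shows "diff_deg_less (Suc (\<Sum>b\<in>B. \<alpha> b)) (\<lambda>x::'a. (\<Prod>b\<in>B. (x \<bullet> b) ^ \<alpha> b) *\<^sub>R c)"
  using assms
proof induction
  case (insert b B)
  have "linear (\<lambda>x. x \<bullet> b)" by (simp add: linear_iff inner_add_left)
  from diff_deg_less_power[OF this insert.IH, of "\<alpha> b"] insert.hyps show ?case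
    by (simp add: add.commute)
qed simp

lemma polynomial_imp_diff_deg_less:
  assumes "polynomial_deg_le d P"
  shows "diff_deg_less (Suc d) P"
proof -
  obtain c where c: "\<And>x. P x = (\<Sum>\<alpha>\<in>exponents_le d. (\<Prod>b\<in>Basis. (x \<bullet> b) ^ \<alpha> b) *\<^sub>R c \<alpha>)"
    using assms unfolding polynomial_deg_le_def by blast
  have "diff_deg_less (Suc d) (\<lambda>x. \<Sum>\<alpha>\<in>exponents_le d. (\<Prod>b\<in>Basis. (x \<bullet> b) ^ \<alpha> b) *\<^sub>R c \<alpha>)"
    by (intro diff_deg_less_sum diff_deg_less_mono[OF diff_deg_less_monomial])
       (auto simp: exponents_le_def)
  then show ?thesis by (simp add: c[abs_def])
qed

section \<open>Valuations on maxima of affine functions\<close>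

definition affine_fun :: "'a::real_inner \<times> real \<Rightarrow> 'a \<Rightarrow> real" where
  "affine_fun p x = fst p \<bullet> x + snd p"

lemma affine_fun_add: "affine_fun (p + q) x = affine_fun p x + affine_fun q x"
  by (simp add: affine_fun_def inner_add_left)

lemma affine_fun_scaleR: "affine_fun (t *\<^sub>R p) x = t * affine_fun p x"
  by (simp add: affine_fun_def algebra_simps)

lemma affine_fun_zero [simp]: "affine_fun 0 x = 0"
  by (simp add: affine_fun_def)

text \<open>The index is the number of listed affine functions minus one, that is, the largest
  possible dimension of the convex hull of their coefficient vectors. This is its contribution to
  the degree bound below.\<close>

inductive max_affine :: "nat \<Rightarrow> ('a::real_inner \<Rightarrow> real) \<Rightarrow> bool" where
  affine: "max_affine 0 (affine_fun p)"
| max: "max_affine k F \<Longrightarrow> max_affine (Suc k) (\<lambda>x. max (affine_fun p x) (F x))"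

definition piecewise :: "('a::real_inner \<Rightarrow> real) set" where
  "piecewise = {F. \<exists>k. max_affine k F}"

lemma max_affine_piecewise: "max_affine k F \<Longrightarrow> F \<in> piecewise"
  by (auto simp: piecewise_def)

lemma affine_fun_piecewise [simp]: "affine_fun p \<in> piecewise"
  using affine max_affine_piecewise by blast

lemma max_affine_add_affine:
  "max_affine k F \<Longrightarrow> max_affine k (\<lambda>x. F x + affine_fun q x)"
proof (induction rule: max_affine.induct)
  case (affine p)
  from max_affine.affine[of "p + q"] show ?case by (simp add: affine_fun_add[abs_def])
next
  case (max k F p)
  from max_affine.max[OF max.IH, of "p + q"] show ?case
    by (simp add: affine_fun_add max_add_distrib_left)
qed

lemma max_affine_scale:
  assumes "t \<ge> 0"
  shows "max_affine k F \<Longrightarrow> max_affine k (\<lambda>x. t * F x)"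
proof (induction rule: max_affine.induct)
  case (affine p)
  from max_affine.affine[of "t *\<^sub>R p"] show ?case by (simp add: affine_fun_scaleR[abs_def])
next
  case (max k F p)
  from max_affine.max[OF max.IH, of "t *\<^sub>R p"] assms show ?case
    by (simp add: affine_fun_scaleR max_mult_distrib_left)
qed

lemma piecewise_add_affine: "F \<in> piecewise \<Longrightarrow> (\<lambda>x. F x + affine_fun q x) \<in> piecewise"
  by (auto simp: piecewise_def intro: max_affine_add_affine)

lemma piecewise_scale: "F \<in> piecewise \<Longrightarrow> t \<ge> 0 \<Longrightarrow> (\<lambda>x. t * F x) \<in> piecewise"
  by (auto simp: piecewise_def intro: max_affine_scale)

lemma piecewise_max:
  assumes "F \<in> piecewise" "G \<in> piecewise"
  shows "(\<lambda>x. max (F x) (G x)) \<in> piecewise"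
proof -
  from assms(1) obtain k where "max_affine k F" by (auto simp: piecewise_def)
  then show ?thesis
  proof induction
    case (affine p)
    show ?case using assms(2) by (auto simp: piecewise_def intro: max_affine.max)
  next
    case (max k F p)
    then show ?case by (auto simp: piecewise_def max.assoc intro: max_affine.max)
  qed
qed

text \<open>A maximum plus a function is the maximum of the sums, so induction over \<open>F\<close>
  reduces to adding an affine function to \<open>G\<close>.\<close>

lemma piecewise_add:
  assumes "F \<in> piecewise" "G \<in> piecewise"
  shows "(\<lambda>x. F x + G x) \<in> piecewise"
proof -
  from assms(1) obtain k where "max_affine k F" by (auto simp: piecewise_def)
  then show ?thesis
  proof induction
    case (affine p)
    from piecewise_add_affine[OF assms(2), of p] show ?case by (simp add: add.commute)
  next
    case (max k F p)
    have "(\<lambda>x. affine_fun p x + G x) \<in> piecewise"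
      using piecewise_add_affine[OF assms(2), of p] by (simp add: add.commute)
    from piecewise_max[OF this max.IH] show ?case by (simp add: max_add_distrib_left)
  qed
qed

section \<open>Valuations and their translation degree\<close>

text \<open>Only the minimum carries a membership condition, since \<open>piecewise\<close> is
  closed under maxima by \<open>piecewise_max\<close>.\<close>

definition piecewise_valuation :: "(('a::real_inner \<Rightarrow> real) \<Rightarrow> 'v::ab_group_add) \<Rightarrow> bool" where
  "piecewise_valuation Y \<longleftrightarrow> (\<forall>F\<in>piecewise. \<forall>G\<in>piecewise. (\<lambda>x. min (F x) (G x)) \<in> piecewise \<longrightarrow>
     Y (\<lambda>x. max (F x) (G x)) + Y (\<lambda>x. min (F x) (G x)) = Y F + Y G)"

text \<open>The recursion passes from a functional to its translation differences, which are again
  valuations, so that an induction on the degree can change \<open>Y\<close> itself.\<close>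

primrec translation_deg_less :: "nat \<Rightarrow> (('a::real_inner \<Rightarrow> real) \<Rightarrow> 'v::ab_group_add) \<Rightarrow> bool" where
  "translation_deg_less 0 Y \<longleftrightarrow> (\<forall>F\<in>piecewise. Y F = 0)"
| "translation_deg_less (Suc e) Y \<longleftrightarrow>
     (\<forall>p. translation_deg_less e (\<lambda>F. Y (\<lambda>x. F x + affine_fun p x) - Y F))"

text \<open>Differencing \<open>p\<close> by \<open>h\<close> in \<open>Y (F + p)\<close> amounts to
  replacing \<open>Y\<close> by its translation difference along \<open>h\<close>; the two
  recursions therefore run in parallel.\<close>

lemma translation_deg_lessI:
  "(\<And>F. F \<in> piecewise \<Longrightarrow> diff_deg_less e (\<lambda>p. Y (\<lambda>x. F x + affine_fun p x)))
    \<Longrightarrow> translation_deg_less e Y"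
proof (induction e arbitrary: Y)
  case 0
  \<comment> \<open>Evaluating at the translation \<open>p = 0\<close> recovers
    \<open>Y F\<close>.\<close>
  show ?case
    using 0[THEN diff_deg_less.simps(1)[THEN iffD1, rule_format], of _ 0] by simp
next
  case (Suc e)
  show ?case
    unfolding translation_deg_less.simps
  proof (intro allI Suc.IH)
    fix h :: "'a \<times> real" and F :: "'a \<Rightarrow> real" assume "F \<in> piecewise"
    from Suc.prems[OF this] have
      "diff_deg_less e (\<lambda>p. Y (\<lambda>x. F x + affine_fun (p + h) x) - Y (\<lambda>x. F x + affine_fun p x))"
      unfolding diff_deg_less.simps by (rule spec)
    then show "diff_deg_less e (\<lambda>p. Y (\<lambda>x. F x + affine_fun p x + affine_fun h x) - Y (\<lambda>x. F x + affine_fun p x))"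
      by (simp add: affine_fun_add add.assoc)
  qed
qed

lemma piecewise_valuation_translation:
  assumes "piecewise_valuation Y"
  shows "piecewise_valuation (\<lambda>F. Y (\<lambda>x. F x + affine_fun p x) - Y F)"
  unfolding piecewise_valuation_def
proof (intro ballI impI)
  fix F G :: "'a \<Rightarrow> real"
  assume *: "F \<in> piecewise" "G \<in> piecewise" "(\<lambda>x. min (F x) (G x)) \<in> piecewise"
  have "Y (\<lambda>x. max (F x) (G x)) + Y (\<lambda>x. min (F x) (G x)) = Y F + Y G"
    using assms * unfolding piecewise_valuation_def by blast
  moreover have "Y (\<lambda>x. max (F x) (G x) + affine_fun p x) + Y (\<lambda>x. min (F x) (G x) + affine_fun p x)
      = Y (\<lambda>x. F x + affine_fun p x) + Y (\<lambda>x. G x + affine_fun p x)"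
    using assms *[THEN piecewise_add_affine, of p] unfolding piecewise_valuation_def
    by (simp add: max_add_distrib_left min_add_distrib_left)
  ultimately show "Y (\<lambda>x. max (F x) (G x) + affine_fun p x) - Y (\<lambda>x. max (F x) (G x))
      + (Y (\<lambda>x. min (F x) (G x) + affine_fun p x) - Y (\<lambda>x. min (F x) (G x)))
      = Y (\<lambda>x. F x + affine_fun p x) - Y F + (Y (\<lambda>x. G x + affine_fun p x) - Y G)"
    by (simp add: algebra_simps)
qed

text \<open>The one-step case of the canonical dissection of a dilated simplex.\<close>

lemma piecewise_valuation_dilation:
  assumes Y: "piecewise_valuation Y" and g: "g \<in> piecewise" and B': "B' \<in> piecewise" and "m \<ge> 0"
    and B: "B = (\<lambda>x. max (affine_fun p x) (B' x))"
  shows "Y (\<lambda>x. g x + (m + 1) * B x) + Y (\<lambda>x. g x + affine_fun p x + m * B' x)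
       = Y (\<lambda>x. g x + affine_fun p x + m * B x) + Y (\<lambda>x. g x + B x + m * B' x)"
proof -
  let ?F = "\<lambda>x. g x + affine_fun p x + m * B x" and ?G = "\<lambda>x. g x + B x + m * B' x"
  have Bp: "B \<in> piecewise" unfolding B by (intro piecewise_max B' affine_fun_piecewise)
  have "?F \<in> piecewise" "?G \<in> piecewise" "(\<lambda>x. g x + affine_fun p x + m * B' x) \<in> piecewise"
    using assms Bp by (auto intro!: piecewise_add piecewise_scale)
  \<comment> \<open>Where \<open>affine_fun p x\<close> is at most \<open>B' x\<close>,
    \<open>B\<close> equals \<open>B'\<close> and \<open>?G\<close> is the larger function;
    elsewhere \<open>B\<close> equals \<open>affine_fun p\<close> and \<open>?F\<close> is the
    larger one.\<close>
  moreover have *: "max (?F x) (?G x) = g x + (m + 1) * B x \<and>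
      min (?F x) (?G x) = g x + affine_fun p x + m * B' x" for x
  proof (cases "affine_fun p x \<le> B' x")
    case True
    then show ?thesis by (simp add: B algebra_simps)
  next
    case False
    then have "m * B' x \<le> m * affine_fun p x" using \<open>m \<ge> 0\<close> by (intro mult_left_mono) auto
    then show ?thesis using False by (simp add: B algebra_simps)
  qed
  ultimately show ?thesis
    using Y[unfolded piecewise_valuation_def, rule_format, of ?F ?G] by (simp only: *[THEN conjunct1] *[THEN conjunct2])
qed

text \<open>Outer induction on the translation degree, inner induction on the construction of
  \<open>B\<close>. The base function \<open>g\<close> stays arbitrary because the dilation identity
  moves \<open>affine_fun p\<close> and \<open>B\<close> into it.\<close>

lemma seq_deg_less_max_affine:
  fixes Y :: "('a::real_inner \<Rightarrow> real) \<Rightarrow> 'v::ab_group_add"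
  assumes "piecewise_valuation Y" "translation_deg_less e Y" "max_affine k B" "g \<in> piecewise"
  shows "seq_deg_less (k + e) (\<lambda>m. Y (\<lambda>x. g x + real m * B x))"
  using assms
proof (induction e arbitrary: k B g Y)
  case 0
  have "(\<lambda>x. g x + real m * B x) \<in> piecewise" for m
    using 0(4) max_affine_piecewise[OF 0(3)] by (intro piecewise_add piecewise_scale) auto
  then have "(\<lambda>m. Y (\<lambda>x. g x + real m * B x)) = (\<lambda>m. 0)"
    using 0(2) by simp
  then show ?case by (simp add: seq_deg_less_zero)
next
  case (Suc e)
  note Y = \<open>piecewise_valuation Y\<close>
  \<comment> \<open>The outer hypothesis for the translation difference of \<open>Y\<close>:
    translating \<open>g\<close> by an affine function changes the sequence only by a term of one
    degree less.\<close>
  have diff: "seq_deg_less (k + e) (\<lambda>m. Y (\<lambda>x. g x + affine_fun p x + real m * B x) - Y (\<lambda>x. g x + real m * B x))"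
    if "max_affine k B" "g \<in> piecewise" for k p and B g :: "'a \<Rightarrow> real"
    using Suc.IH[OF piecewise_valuation_translation[OF Y] _ that] Suc.prems(2)
    by (simp add: add_ac del: split_paired_All)
  from Suc.prems(3,4) show ?case
  proof (induction arbitrary: g)
    case (affine p)
    \<comment> \<open>For \<open>B = affine_fun p\<close>, translating by \<open>p\<close> is the
      same as raising \<open>m\<close> by one, so \<open>diff\<close> bounds the forward difference
      directly.\<close>
    from diff[OF max_affine.affine affine, of p p] show ?case
      by (simp add: algebra_simps)
  next
    case (max k B' p)
    define B where "B = (\<lambda>x. max (affine_fun p x) (B' x))"
    have B: "max_affine (Suc k) B" unfolding B_def by (intro max_affine.max max)
    have pw: "(\<lambda>x. g x + affine_fun p x) \<in> piecewise" "(\<lambda>x. g x + B x) \<in> piecewise"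
      using max.prems B max_affine_piecewise by (auto intro!: piecewise_add)
    have "seq_deg_less (k + Suc e) (\<lambda>m. Y (\<lambda>x. g x + affine_fun p x + real m * B x) - Y (\<lambda>x. g x + real m * B x))"
      using diff[OF B max.prems, of p] by (simp del: seq_deg_less.simps)
    moreover have "seq_deg_less (k + Suc e)
       (\<lambda>m. Y (\<lambda>x. g x + B x + real m * B' x) - Y (\<lambda>x. g x + affine_fun p x + real m * B' x))"
      by (intro seq_deg_less_diff max.IH pw)
    ultimately have "seq_deg_less (k + Suc e) (\<lambda>m.
       (Y (\<lambda>x. g x + affine_fun p x + real m * B x) - Y (\<lambda>x. g x + real m * B x))
       + (Y (\<lambda>x. g x + B x + real m * B' x) - Y (\<lambda>x. g x + affine_fun p x + real m * B' x)))"
      by (rule seq_deg_less_add)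
    \<comment> \<open>The dilation identity splits the forward difference into a translation
      difference, bounded by \<open>diff\<close>, and a difference of two sequences for
      \<open>B'\<close>, bounded by the inner hypothesis.\<close>
    moreover have "Y (\<lambda>x. g x + real (Suc m) * B x) - Y (\<lambda>x. g x + real m * B x)
       = (Y (\<lambda>x. g x + affine_fun p x + real m * B x) - Y (\<lambda>x. g x + real m * B x))
       + (Y (\<lambda>x. g x + B x + real m * B' x) - Y (\<lambda>x. g x + affine_fun p x + real m * B' x))" for m
      using piecewise_valuation_dilation[OF Y max.prems max_affine_piecewise[OF max.hyps] _ B_def, of "real m"]
      by (simp add: add.commute[of _ 1] algebra_simps)
    ultimately have "seq_deg_less (k + Suc e) (\<lambda>m. Y (\<lambda>x. g x + real (Suc m) * B x) - Y (\<lambda>x. g x + real m * B x))"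
      by (simp only:)
    then show ?case unfolding B_def add_Suc seq_deg_less.simps(2)[of "k + Suc e"] .
  qed
qed

section \<open>Affine dependences and reduction of the number of pieces\<close>

text \<open>Finite sets of coefficient pairs make cardinalities and affine dependences accessible.
  The value is meaningful for finite non-empty \<open>S\<close> only, whence the side conditions
  that follow.\<close>

definition max_over :: "('a::real_inner \<times> real) set \<Rightarrow> 'a \<Rightarrow> real" where
  "max_over S x = Max ((\<lambda>p. affine_fun p x) ` S)"

lemma max_over_insert:
  "finite S \<Longrightarrow> S \<noteq> {} \<Longrightarrow> max_over (insert p S) x = max (affine_fun p x) (max_over S x)"
  by (simp add: max_over_def)

lemma max_over_ge: "finite S \<Longrightarrow> p \<in> S \<Longrightarrow> affine_fun p x \<le> max_over S x"
  by (simp add: max_over_def)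

lemma max_affine_max_over:
  "finite S \<Longrightarrow> S \<noteq> {} \<Longrightarrow> max_affine (card S - 1) (max_over S)"
proof (induction rule: finite_ne_induct)
  case (singleton p)
  have "max_over {p} = affine_fun p" by (simp add: max_over_def fun_eq_iff)
  then show ?case by (simp add: max_affine.affine)
next
  case (insert p S)
  have "max_over (insert p S) = (\<lambda>x. max (affine_fun p x) (max_over S x))"
    using insert by (simp add: max_over_insert fun_eq_iff)
  moreover have "card (insert p S) - 1 = Suc (card S - 1)"
    using insert by (simp add: card_gt_0_iff)
  ultimately show ?case using max_affine.max[OF insert.IH, of p] by simp
qed

lemma max_affine_imp_max_over:
  "max_affine k F \<Longrightarrow> \<exists>S. finite S \<and> S \<noteq> {} \<and> F = max_over S"
proof (induction rule: max_affine.induct)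
  case (affine p)
  have "affine_fun p = max_over {p}" by (simp add: max_over_def fun_eq_iff)
  then show ?case by blast
next
  case (max k F p)
  then obtain S where "finite S" "S \<noteq> {}" "F = max_over S" by blast
  then show ?case
    by (intro exI[of _ "insert p S"]) (simp add: max_over_insert fun_eq_iff)
qed

lemma affine_dependence:
  fixes S :: "('a::euclidean_space \<times> real) set"
  assumes "finite S" "card S > DIM('a) + 1"
  obtains c where "sum c S = 0" "(\<Sum>p\<in>S. c p *\<^sub>R fst p) = 0" "\<exists>p\<in>S. c p \<noteq> 0"
proof -
  \<comment> \<open>Appending the coordinate 1 turns affine dependence of the gradients into linear
    dependence in a space of dimension \<open>DIM('a) + 1\<close>.\<close>
  define v where "v p = (fst p, 1::real)" for p :: "'a \<times> real"
  show thesis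
  proof (cases "inj_on v S")
    case True
    then have "card (v ` S) > DIM('a \<times> real)" using assms by (simp add: card_image)
    then have "dependent (v ` S)" using assms(1) by (intro dependent_biggerset) auto
    then obtain u where u: "\<exists>y\<in>v ` S. u y \<noteq> 0" "(\<Sum>y\<in>v ` S. u y *\<^sub>R y) = 0"
      using assms(1) by (auto simp: dependent_finite)
    then have "(\<Sum>p\<in>S. u (v p) *\<^sub>R v p) = 0" using True by (simp add: sum.reindex)
    from arg_cong[OF this, of fst] arg_cong[OF this, of snd] u(1)
    show thesis by (intro that[of "u \<circ> v"]) (auto simp: fst_sum snd_sum v_def)
  next
    case False
    then obtain p q where pq: "p \<in> S" "q \<in> S" "p \<noteq> q" "fst p = fst q"
      by (auto simp: inj_on_def v_def)
    \<comment> \<open>Two functions with the same gradient are dependent at once, with coefficients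
      1 and -1.\<close>
    define c where "c s = (if s = p then 1 else 0) - (if s = q then 1 else (0::real))" for s
    show thesis
    proof (rule that[of c])
      show "sum c S = 0" using assms(1) pq by (simp add: c_def sum_subtractf)
      have "(\<Sum>s\<in>S. c s *\<^sub>R fst s) = (\<Sum>s\<in>S. (if s = p then fst p else 0) - (if s = q then fst q else 0))"
        by (intro sum.cong) (auto simp: c_def)
      then show "(\<Sum>s\<in>S. c s *\<^sub>R fst s) = 0" using assms(1) pq by (simp add: sum_subtractf)
      show "\<exists>s\<in>S. c s \<noteq> 0" using pq by (intro bexI[of _ p]) (auto simp: c_def)
    qed
  qed
qed

text \<open>Dividing the dependence by \<open>- c j\<close> bounds \<open>affine_fun j\<close> by a
  convex combination of the other affine functions: the gradients cancel and the constants leave a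
  term of the right sign. Hence \<open>j\<close> never contributes to the maximum.\<close>

lemma max_over_redundant:
  assumes S: "finite S" "j \<in> S" and neg: "{p \<in> S. c p < 0} = {j}"
    and c: "sum c S = 0" "(\<Sum>p\<in>S. c p *\<^sub>R fst p) = 0" "(\<Sum>p\<in>S. c p * snd p) \<ge> 0"
  shows "S - {j} \<noteq> {}" "max_over S = max_over (S - {j})"
proof -
  have cj: "c j < 0" using neg by blast
  have cS: "(\<Sum>p\<in>S - {j}. c p) = - c j" using c(1) S by (simp add: sum_diff1)
  show ne: "S - {j} \<noteq> {}"
  proof
    assume "S - {j} = {}"
    then have "(\<Sum>p\<in>S - {j}. c p) = 0" by (simp only: sum.empty)
    then show False using cS cj by linarith
  qed
  have "affine_fun j x \<le> max_over (S - {j}) x" for x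
  proof -
    let ?M = "max_over (S - {j}) x"
    \<comment> \<open>The linear part vanishes by the dependence, which leaves the non-negative sum
      of constants.\<close>
    have "(\<Sum>p\<in>S. c p * affine_fun p x) = (\<Sum>p\<in>S. c p *\<^sub>R fst p) \<bullet> x + (\<Sum>p\<in>S. c p * snd p)"
      by (simp add: affine_fun_def inner_sum_left sum.distrib algebra_simps)
    then have "0 \<le> (\<Sum>p\<in>S. c p * affine_fun p x)" using c by simp
    then have "- c j * affine_fun j x \<le> (\<Sum>p\<in>S - {j}. c p * affine_fun p x)"
      using S by (simp add: sum_diff1)
    also have "\<dots> \<le> (\<Sum>p\<in>S - {j}. c p * ?M)"
    proof (intro sum_mono mult_left_mono)
      fix p assume p: "p \<in> S - {j}"
      then show "affine_fun p x \<le> ?M" using S by (intro max_over_ge) auto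
      show "c p \<ge> 0"
      proof (rule ccontr)
        assume "\<not> c p \<ge> 0"
        then have "p \<in> {p \<in> S. c p < 0}" using p by simp
        then show False using p unfolding neg by simp
      qed
    qed
    also have "\<dots> = - c j * ?M" by (simp add: sum_distrib_right[symmetric] cS)
    finally show ?thesis using cj by simp
  qed
  moreover have "max_over (insert j (S - {j})) x = max (affine_fun j x) (max_over (S - {j}) x)" for x
    using S(1) by (intro max_over_insert ne) simp
  ultimately have "max_over (insert j (S - {j})) = max_over (S - {j})"
    by (intro ext) (simp only: max_absorb2)
  then show "max_over S = max_over (S - {j})" by (simp only: insert_Diff[OF S(2)])
qed

text \<open>Given an affine dependence, subdividing an edge between two vertices of the same sign merges
  their coefficients; once a single negative coefficient is left, its vertex is redundant.\<close>

lemma max_over_dependence_induct: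
  fixes P :: "('a::euclidean_space \<Rightarrow> real) \<Rightarrow> bool"
  assumes small: "\<And>T. finite T \<Longrightarrow> T \<noteq> {} \<Longrightarrow> card T < card S \<Longrightarrow> P (max_over T)"
    and edge: "\<And>p q T. finite T \<Longrightarrow> T \<noteq> {} \<Longrightarrow> (\<And>x. min (affine_fun p x) (affine_fun q x) \<le> max_over T x) \<Longrightarrow>
      P (max_over (insert p T)) \<Longrightarrow> P (max_over (insert q T)) \<Longrightarrow> P (max_over T) \<Longrightarrow>
      P (\<lambda>x. max (affine_fun p x) (max (affine_fun q x) (max_over T x)))"
    and S: "finite S" and neg: "{p \<in> S. c p < 0} \<noteq> {}"
    and c: "sum c S = 0" "(\<Sum>p\<in>S. c p *\<^sub>R fst p) = 0" "(\<Sum>p\<in>S. c p * snd p) \<ge> 0"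
  shows "P (max_over S)"
  \<comment> \<open>The assumption \<open>small\<close> mentions \<open>S\<close> and is generalised
    along with it; \<open>edge\<close> stays fixed.\<close>
  using assms(1,3-)
proof (induction "card {p \<in> S. c p < 0}" arbitrary: S c rule: less_induct)
  case less
  note S = less.prems(2) and c = less.prems(4-6)
  let ?J = "{p \<in> S. c p < 0}"
  obtain j where j: "j \<in> ?J" using less.prems(3) by blast
  show ?case
  proof (cases "?J = {j}")
    case True
    have "card (S - {j}) < card S" using S j by (intro card_Diff1_less) auto
    with max_over_redundant[OF S _ True c] less.prems(1)[of "S - {j}"] S j show ?thesis by simp
  next
    case False
    then obtain i where i: "i \<in> ?J" "i \<noteq> j" using j by blast
    \<comment> \<open>The mean of \<open>i\<close> and \<open>j\<close> with weights
      \<open>c i\<close> and \<open>c j\<close>. Placing the coefficient \<open>c i + c j\<close> at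
      \<open>q\<close> leaves the dependence and its constant part unchanged.\<close>
    define q where "q = (1 / (c i + c j)) *\<^sub>R (c i *\<^sub>R i + c j *\<^sub>R j)"
    have neg: "c i < 0" "c j < 0" using i j by auto
    then have q: "(c i + c j) *\<^sub>R q = c i *\<^sub>R i + c j *\<^sub>R j" by (simp add: q_def)
    have qi: "q \<noteq> i"
    proof
      assume "q = i"
      then have "c j *\<^sub>R i = c j *\<^sub>R j" using q by (simp add: scaleR_left_distrib)
      then show False using neg i by simp
    qed
    have qj: "q \<noteq> j"
    proof
      assume "q = j"
      then have "c i *\<^sub>R i = c i *\<^sub>R j" using q by (auto simp: scaleR_left_distrib)
      then show False using neg i by simp
    qed
    have ij: "i \<in> S" "j \<in> S" using i j by auto
    define T0 where "T0 = S - {i, j}"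
    have S_eq: "S = insert i (insert j T0)" using ij by (auto simp: T0_def)
    have T0: "finite T0" "i \<notin> T0" "j \<notin> T0" using S by (auto simp: T0_def)
    have cardS: "card S = Suc (Suc (card T0))" using T0 i by (simp add: S_eq)
    define T where "T = insert q T0"
    have T: "finite T" "T \<noteq> {}" using T0 by (auto simp: T_def)
    have cardT: "card T < card S" unfolding cardS T_def using card_insert_le_m1[of "Suc (card T0)" T0 q] by simp
    \<comment> \<open>One endpoint of the edge is kept and the other is replaced by
      \<open>q\<close>. If \<open>q\<close> was already a vertex, the set has shrunk and
      \<open>small\<close> applies; otherwise the merged dependence has one negative coefficient
      fewer.\<close>
    have subdivided: "P (max_over (insert k T))" if k: "k \<in> {i, j}" for k
    proof (cases "q \<in> T0")
      case True
      then have "card (insert k T) < card S"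
        unfolding cardS T_def insert_absorb[OF True] by (metis card_insert_le_m1 diff_Suc_1 le_imp_less_Suc order_refl zero_less_Suc)
      then show ?thesis using T by (intro less.prems(1)) auto
    next
      case False
      have kT: "k \<notin> T" using k T0 qi qj by (auto simp: T_def)
      define c' where "c' p = (if p = q then c i + c j else if p \<in> {i, j} then 0 else c p)" for p
      \<comment> \<open>Taking the constant 1, \<open>fst\<close> and \<open>snd\<close> for \<phi>
        gives the three conditions on the new dependence. The endpoint that is kept has coefficient
        0.\<close>
      have same: "(\<Sum>p\<in>insert k T. c' p *\<^sub>R \<phi> p) = (\<Sum>p\<in>S. c p *\<^sub>R \<phi> p)"
        if "(c i + c j) *\<^sub>R \<phi> q = c i *\<^sub>R \<phi> i + c j *\<^sub>R \<phi> j" for \<phi> :: "'a \<times> real \<Rightarrow> 'b::real_vector"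
      proof -
        have "(\<Sum>p\<in>insert k T. c' p *\<^sub>R \<phi> p) = (\<Sum>p\<in>T. c' p *\<^sub>R \<phi> p)"
          using kT k T qi qj by (auto simp: c'_def)
        also have "\<dots> = (c i + c j) *\<^sub>R \<phi> q + (\<Sum>p\<in>T0. c' p *\<^sub>R \<phi> p)"
          using False T0 by (simp add: T_def c'_def)
        also have "(\<Sum>p\<in>T0. c' p *\<^sub>R \<phi> p) = (\<Sum>p\<in>T0. c p *\<^sub>R \<phi> p)"
          using False T0 by (intro sum.cong) (auto simp: c'_def)
        also have "(c i + c j) *\<^sub>R \<phi> q + \<dots> = (\<Sum>p\<in>S. c p *\<^sub>R \<phi> p)"
          using T0 i(2) that by (simp add: S_eq add.assoc)
        finally show ?thesis .
      qed
      have J': "{p \<in> insert k T. c' p < 0} = insert q (?J - {i, j})"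
        using k neg qi qj False by (auto simp: c'_def T_def T0_def)
      have "card (insert q (?J - {i, j})) = Suc (card (?J - {i, j}))"
        using False S qi qj by (subst card_insert_disjoint) (auto simp: T0_def)
      also have "\<dots> < card ?J"
      proof -
        have "?J = insert i (insert j (?J - {i, j}))" using i j by blast
        moreover have "card (insert i (insert j (?J - {i, j}))) = Suc (Suc (card (?J - {i, j})))"
          using S i(2) by simp
        ultimately show ?thesis by simp
      qed
      finally have "card {p \<in> insert k T. c' p < 0} < card ?J" by (simp only: J')
      then show ?thesis
      proof (rule less.hyps)
        \<comment> \<open>\<open>insert k T\<close> has exactly as many elements as
          \<open>S\<close>, so \<open>small\<close> is inherited.\<close>
        show "P (max_over U)" if "finite U" "U \<noteq> {}" "card U < card (insert k T)" for U
        proof (rule less.prems(1)[OF that(1,2)])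
          show "card U < card S" using that(3) cardS kT T T0 False by (simp add: T_def)
        qed
        show "finite (insert k T)" using T by simp
        show "{p \<in> insert k T. c' p < 0} \<noteq> {}" by (simp only: J') simp
        show "sum c' (insert k T) = 0"
          using same[of "\<lambda>_. 1::real"] c(1) by simp
        show "(\<Sum>p\<in>insert k T. c' p *\<^sub>R fst p) = 0"
          using same[of fst] c(2) arg_cong[OF q, of fst] by simp
        show "(\<Sum>p\<in>insert k T. c' p * snd p) \<ge> 0"
          using same[of snd] c(3) arg_cong[OF q, of snd] by simp
      qed
    qed
    \<comment> \<open>\<open>q\<close> lies between \<open>i\<close> and \<open>j\<close>, so its
      affine function lies between theirs pointwise; the negative weights reverse each
      inequality.\<close>
    have min: "min (affine_fun i x) (affine_fun j x) \<le> max_over T x" for x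
    proof -
      have "(c i + c j) * affine_fun q x = c i * affine_fun i x + c j * affine_fun j x"
        using arg_cong[OF q, of "\<lambda>p. affine_fun p x"] by (simp add: affine_fun_add affine_fun_scaleR)
      also have "\<dots> \<le> c i * min (affine_fun i x) (affine_fun j x) + c j * min (affine_fun i x) (affine_fun j x)"
        using neg by (intro add_mono mult_left_mono_neg) auto
      finally have "(c i + c j) * affine_fun q x \<le> (c i + c j) * min (affine_fun i x) (affine_fun j x)"
        by (simp add: algebra_simps)
      then have "min (affine_fun i x) (affine_fun j x) \<le> affine_fun q x"
        using neg by (simp add: mult_le_cancel_left)
      also have "\<dots> \<le> max_over T x" using T by (intro max_over_ge) (auto simp: T_def)
      finally show "min (affine_fun i x) (affine_fun j x) \<le> max_over T x" .
    qed
    have "affine_fun q x \<le> max (affine_fun i x) (affine_fun j x)" for x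
    proof -
      have "c i * max (affine_fun i x) (affine_fun j x) + c j * max (affine_fun i x) (affine_fun j x)
          \<le> c i * affine_fun i x + c j * affine_fun j x"
        using neg by (intro add_mono mult_left_mono_neg) auto
      also have "\<dots> = (c i + c j) * affine_fun q x"
        using arg_cong[OF q, of "\<lambda>p. affine_fun p x"] by (simp add: affine_fun_add affine_fun_scaleR)
      finally have "(c i + c j) * max (affine_fun i x) (affine_fun j x) \<le> (c i + c j) * affine_fun q x"
        by (simp add: algebra_simps)
      then show ?thesis using neg by (simp add: mult_le_cancel_left)
    qed
    note q_le = this
    have "max (affine_fun i x) (max (affine_fun j x) (max_over T x)) = max_over S x" for x
    proof (cases "T0 = {}")
      case True
      then have "max_over T x = affine_fun q x" "max_over S x = max (affine_fun i x) (affine_fun j x)"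
        by (simp_all add: T_def S_eq max_over_def)
      then show ?thesis using q_le[of x] by linarith
    next
      case False
      then have "max_over T x = max (affine_fun q x) (max_over T0 x)"
        "max_over S x = max (affine_fun i x) (max (affine_fun j x) (max_over T0 x))"
        using T0 by (simp_all add: T_def S_eq max_over_insert)
      then show ?thesis using q_le[of x] by linarith
    qed
    then have "max_over S = (\<lambda>x. max (affine_fun i x) (max (affine_fun j x) (max_over T x)))"
      by (simp add: fun_eq_iff)
    moreover have "P (max_over T)" using T cardT by (intro less.prems(1))
    ultimately show ?thesis
      using edge[OF T min] subdivided by simp
  qed
qed

text \<open>Up to \<open>DIM('a) + 1\<close> affine functions the bound from
  \<open>seq_deg_less_max_affine\<close> suffices. Beyond that number an affine dependence expresses
  the sequence through those of smaller sets, so the bound no longer grows with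
  \<open>card S\<close>.\<close>

lemma seq_deg_less_max_over:
  fixes S :: "('a::euclidean_space \<times> real) set" and Y :: "('a \<Rightarrow> real) \<Rightarrow> 'v::ab_group_add"
  assumes Y: "piecewise_valuation Y" "translation_deg_less e Y" and S: "finite S" "S \<noteq> {}"
  shows "seq_deg_less (DIM('a) + e) (\<lambda>m. Y (\<lambda>x. real m * max_over S x))"
  using S
proof (induction "card S" arbitrary: S rule: less_induct)
  case less
  let ?P = "\<lambda>F. seq_deg_less (DIM('a) + e) (\<lambda>m. Y (\<lambda>x. real m * F x))"
  show ?case
  proof (cases "card S > DIM('a) + 1")
    case False
    have "seq_deg_less (card S - 1 + e) (\<lambda>m. Y (\<lambda>x. affine_fun 0 x + real m * max_over S x))"
      by (intro seq_deg_less_max_affine Y max_affine_max_over less.prems affine_fun_piecewise)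
    then have "seq_deg_less (card S - 1 + e) (\<lambda>m. Y (\<lambda>x. real m * max_over S x))" by simp
    then show ?thesis by (rule seq_deg_less_mono) (use False in simp)
  next
    case True
    obtain c0 where c0: "sum c0 S = 0" "(\<Sum>p\<in>S. c0 p *\<^sub>R fst p) = 0" "\<exists>p\<in>S. c0 p \<noteq> 0"
      using affine_dependence[OF less.prems(1) True] by blast
    \<comment> \<open>The sign that makes the constant part of the dependence non-negative.\<close>
    define \<sigma> where "\<sigma> = (if (\<Sum>p\<in>S. c0 p * snd p) \<ge> 0 then 1 else -1 :: real)"
    define c where "c p = \<sigma> * c0 p" for p
    have "\<sigma> \<noteq> 0" by (simp add: \<sigma>_def)
    have c: "sum c S = 0" "(\<Sum>p\<in>S. c p *\<^sub>R fst p) = 0"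
      using c0 by (simp_all add: c_def sum_distrib_left[symmetric] scaleR_scaleR[symmetric] scaleR_sum_right[symmetric] del: scaleR_scaleR)
    have c3: "(\<Sum>p\<in>S. c p * snd p) \<ge> 0"
      by (auto simp: c_def \<sigma>_def mult.assoc sum_distrib_left[symmetric] sum_negf)
    have neg: "{p \<in> S. c p < 0} \<noteq> {}"
    proof
      assume "{p \<in> S. c p < 0} = {}"
      then have "\<forall>p\<in>S. c p \<ge> 0" by (auto simp: not_less)
      then have "\<forall>p\<in>S. c p = 0" using c(1) less.prems(1) by (simp add: sum_nonneg_eq_0_iff)
      then show False using c0(3) \<open>\<sigma> \<noteq> 0\<close> by (auto simp: c_def)
    qed
    show ?thesis
    proof (rule max_over_dependence_induct[where P = ?P, OF _ _ less.prems(1) neg c c3])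
      show "?P (max_over T)" if "finite T" "T \<noteq> {}" "card T < card S" for T
        using less.hyps[OF that(3,1,2)] .
    next
      fix p q and T :: "('a \<times> real) set"
      assume T: "finite T" "T \<noteq> {}" and le: "\<And>x. min (affine_fun p x) (affine_fun q x) \<le> max_over T x"
        and P: "?P (max_over (insert p T))" "?P (max_over (insert q T))" "?P (max_over T)"
      let ?F = "\<lambda>x. max (affine_fun p x) (max (affine_fun q x) (max_over T x))"
      have pw: "(\<lambda>x. t * max_over U x) \<in> piecewise" if "finite U" "U \<noteq> {}" "t \<ge> 0" for t and U :: "('a \<times> real) set"
        using that by (intro piecewise_scale max_affine_piecewise[OF max_affine_max_over])
      \<comment> \<open>The valuation property for the maxima over \<open>insert p T\<close> and
        \<open>insert q T\<close>: their minimum is \<open>max_over T\<close>, because the minimum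
        of the two affine functions lies below it.\<close>
      have "Y (\<lambda>x. t * ?F x) = Y (\<lambda>x. t * max_over (insert p T) x) + Y (\<lambda>x. t * max_over (insert q T) x)
          - Y (\<lambda>x. t * max_over T x)" if t: "t \<ge> 0" for t
      proof -
        let ?A = "\<lambda>x. t * max_over (insert p T) x" and ?B = "\<lambda>x. t * max_over (insert q T) x"
        have "max (?A x) (?B x) = t * ?F x" for x
        proof -
          have "max (?A x) (?B x) = t * max (max_over (insert p T) x) (max_over (insert q T) x)"
            using t by (simp add: max_mult_distrib_left)
          also have "max (max_over (insert p T) x) (max_over (insert q T) x)
              = max (affine_fun p x) (max (affine_fun q x) (max_over T x))"
            using T by (simp add: max_over_insert ac_simps)
          finally show ?thesis .
        qed
        moreover have "min (?A x) (?B x) = t * max_over T x" for x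
        proof -
          have "min (?A x) (?B x) = t * min (max_over (insert p T) x) (max_over (insert q T) x)"
            using t by (simp add: min_mult_distrib_left)
          also have "min (max_over (insert p T) x) (max_over (insert q T) x)
              = max (min (affine_fun p x) (affine_fun q x)) (max_over T x)"
            using T by (simp add: max_over_insert max_min_distrib1)
          also have "\<dots> = max_over T x" using le by (simp add: max_absorb2)
          finally show ?thesis .
        qed
        ultimately show ?thesis
          using Y(1)[unfolded piecewise_valuation_def, rule_format, of ?A ?B] T t pw
          by (simp add: eq_diff_eq)
      qed
      then show "?P ?F"
        using seq_deg_less_diff[OF seq_deg_less_add[OF P(1,2)] P(3)] by simp
    qed
  qed
qed

section \<open>Piecewise affine functions in the cone\<close>

definition on_domain :: "'a set \<Rightarrow> ('a \<Rightarrow> real) \<Rightarrow> 'a \<Rightarrow> ereal" where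
  "on_domain A F x = ereal (F x) + convex_indicator A x"

lemma on_domain_simps: "on_domain A F x = (if x \<in> A then ereal (F x) else \<infinity>)"
  by (simp add: on_domain_def convex_indicator_def)

lemma on_domain_scale: "t > 0 \<Longrightarrow> (\<lambda>x. ereal t * on_domain A F x) = on_domain A (\<lambda>x. t * F x)"
  by (auto simp: on_domain_simps fun_eq_iff)

section \<open>Support functions and membership in the cone\<close>

lemma bdd_above_inner_compact:
  fixes K :: "'b::real_inner set"
  shows "compact K \<Longrightarrow> bdd_above ((\<bullet>) z ` K)"
  by (intro bounded_imp_bdd_above compact_imp_bounded compact_continuous_image continuous_intros)

lemma support_fun_insert:
  fixes K :: "'b::real_inner set"
  assumes "compact K" "K \<noteq> {}"
  shows "support_fun (insert w K) z = max (z \<bullet> w) (support_fun K z)"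
  unfolding support_fun_def
  using cSUP_insert[OF assms(2) bdd_above_inner_compact[OF assms(1)], of z w] by (simp add: sup_max)

lemma support_fun_convex_hull:
  fixes K :: "'b::euclidean_space set"
  assumes "compact K" "K \<noteq> {}"
  shows "support_fun (convex hull K) z = support_fun K z"
  unfolding support_fun_def
proof (rule antisym)
  have "z \<bullet> w \<le> (SUP w\<in>K. z \<bullet> w)" if "w \<in> K" for w
    using that bdd_above_inner_compact[OF assms(1)] by (rule cSUP_upper)
  then have "convex hull K \<subseteq> {w. z \<bullet> w \<le> (SUP w\<in>K. z \<bullet> w)}"
    by (intro hull_minimal convex_halfspace_le) auto
  then show "(SUP w\<in>convex hull K. z \<bullet> w) \<le> (SUP w\<in>K. z \<bullet> w)"
    using assms(2) by (intro cSUP_least) auto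
  show "(SUP w\<in>K. z \<bullet> w) \<le> (SUP w\<in>convex hull K. z \<bullet> w)"
    using assms bdd_above_inner_compact[OF compact_convex_hull[OF assms(1)]]
    by (intro cSUP_subset_mono hull_subset) auto
qed

text \<open>The affine function with coefficients \<open>(a, b)\<close> is the support function of
  the point \<open>(a, - b)\<close> at \<open>(x, -1)\<close>, and adding a point to
  \<open>K\<close> before taking the convex hull corresponds to a maximum.\<close>

lemma max_affine_support_fun:
  fixes F :: "'a::euclidean_space \<Rightarrow> real"
  shows "max_affine k F \<Longrightarrow> \<exists>K :: ('a \<times> real) set. K \<noteq> {} \<and> compact K \<and> convex K \<and> (\<forall>x. F x = support_fun K (x, -1))"
proof (induction rule: max_affine.induct)
  case (affine p)
  show ?case
    by (intro exI[of _ "{(fst p, - snd p)}"]) (simp add: support_fun_def affine_fun_def inner_commute)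
next
  case (max k F p)
  then obtain K :: "('a \<times> real) set" where K: "K \<noteq> {}" "compact K" "convex K" "\<And>x. F x = support_fun K (x, -1)"
    by blast
  have "max (affine_fun p x) (F x) = support_fun (convex hull insert (fst p, - snd p) K) (x, -1)" for x
    using K by (simp add: support_fun_convex_hull support_fun_insert affine_fun_def inner_commute)
  then show ?case
    using K by (intro exI[of _ "convex hull insert (fst p, - snd p) K"]) (simp add: compact_convex_hull)
qed

lemma on_domain_in_cone:
  assumes "AO_cone \<A> \<O> \<Gamma>" "F \<in> piecewise"
  shows "on_domain \<A> F \<in> \<Gamma>"
proof -
  obtain K :: "('a \<times> real) set" where K: "K \<noteq> {}" "compact K" "convex K" "\<And>x. F x = support_fun K (x, -1)"
    using assms(2) max_affine_support_fun unfolding piecewise_def by blast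
  then have "on_domain \<A> F = (\<lambda>x. ereal (support_fun K (x, -1)) + convex_indicator \<A> x)"
    by (simp add: on_domain_def fun_eq_iff)
  then show ?thesis using assms(1) K(1-3) unfolding AO_cone_def by simp
qed

section \<open>Approximation by piecewise affine functions\<close>

lemma closed_epigraph:
  fixes f :: "'a::metric_space \<Rightarrow> ereal"
  assumes "lower_semicont f"
  shows "closed {(x, y). f x \<le> ereal y}"
proof -
  have "\<exists>U. open U \<and> z \<in> U \<and> U \<subseteq> {(x, y). f x > ereal y}" if z: "z \<in> {(x, y). f x > ereal y}" for z
  proof -
    obtain x y where xy: "z = (x, y)" by (cases z)
    then have "ereal y < f x" using z by simp
    then obtain q where q: "ereal y < ereal q" "ereal q < f x" using ereal_dense2 by blast
    have "f x \<le> Liminf (at x) f" using assms by (simp add: lower_semicont_def)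
    then have "\<forall>\<^sub>F u in at x. ereal q < f u" using q(2) by (simp add: le_Liminf_iff)
    then obtain V where V: "open V" "x \<in> V" "\<And>u. u \<in> V \<Longrightarrow> u \<noteq> x \<Longrightarrow> ereal q < f u"
      unfolding eventually_at_topological by blast
    have "f u > ereal v" if "u \<in> V" "v < q" for u v
    proof -
      \<comment> \<open>\<open>Liminf (at x)\<close> ignores the point \<open>x\<close>, where the
        bound comes from the choice of \<open>q\<close>.\<close>
      have "ereal q < f u" using V(3)[OF that(1)] q(2) by (cases "u = x") auto
      then show ?thesis using that(2) by (meson less_ereal.simps(1) less_trans)
    qed
    then have "V \<times> {..<q} \<subseteq> {(x, y). f x > ereal y}" by auto
    moreover have "z \<in> V \<times> {..<q}" using V q xy by simp
    ultimately show ?thesis using V(1) open_Times[OF V(1) open_lessThan[of q]] by blast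
  qed
  then have "open {(x, y). f x > ereal y}" by (subst open_subopen) blast
  moreover have "- {(x, y). f x \<le> ereal y} = {(x, y). f x > ereal y}" by auto
  ultimately show ?thesis by (simp add: closed_def)
qed

lemma convex_epigraph:
  fixes f :: "'a::real_vector \<Rightarrow> ereal"
  assumes "convex_ereal f"
  shows "convex {(x, y). f x \<le> ereal y}"
  unfolding convex_alt
proof (intro ballI allI impI)
  fix z w :: "'a \<times> real" and u :: real
  assume zw: "z \<in> {(x, y). f x \<le> ereal y}" "w \<in> {(x, y). f x \<le> ereal y}" and u: "0 \<le> u \<and> u \<le> 1"
  obtain x y x' y' where xy: "z = (x, y)" "w = (x', y')" by (cases z, cases w)
  consider "u = 0" | "u = 1" | "0 < u" "u < 1" using u by linarith
  then show "(1 - u) *\<^sub>R z + u *\<^sub>R w \<in> {(x, y). f x \<le> ereal y}"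
  proof cases
    case 3
    then have "f ((1 - u) *\<^sub>R x + u *\<^sub>R x') \<le> ereal (1 - u) * f x + ereal u * f x'"
      using assms by (simp add: convex_ereal_def)
    also have "\<dots> \<le> ereal (1 - u) * ereal y + ereal u * ereal y'"
      using 3 zw xy by (intro add_mono ereal_mult_left_mono) auto
    finally show ?thesis by (simp add: xy)
  qed (use zw in simp_all)
qed

text \<open>A hyperplane separating \<open>(x0, r)\<close> from the epigraph is the graph of the
  required minorant unless it is vertical. In the vertical case a large multiple of it is added to
  an arbitrary minorant.\<close>

lemma Conv_affine_minorant:
  fixes f :: "'a::euclidean_space \<Rightarrow> ereal"
  assumes f: "f \<in> Conv" and r: "ereal r < f x0"
  obtains p where "\<And>x. ereal (affine_fun p x) \<le> f x" "r < affine_fun p x0"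
proof -
  define E where "E = {(x, y). f x \<le> ereal y}"
  have E: "closed E" "convex E"
    using f closed_epigraph convex_epigraph by (auto simp: Conv_def E_def)
  obtain x1 where "f x1 \<noteq> \<infinity>" "f x1 \<noteq> -\<infinity>" using f by (auto simp: Conv_def)
  then obtain y1 where y1: "f x1 = ereal y1" by (cases "f x1") auto
  have sep: "\<exists>u s b. u \<bullet> x0 + s * r < b \<and> (\<forall>x y. f x \<le> ereal y \<longrightarrow> u \<bullet> x + s * y > b) \<and> s \<ge> 0"
    if r: "ereal r < f x0" for x0 r
  proof -
    have "(x0, r) \<notin> E" using r by (simp add: E_def)
    then obtain a b where ab: "a \<bullet> (x0, r) < b" "\<And>z. z \<in> E \<Longrightarrow> a \<bullet> z > b"
      using separating_hyperplane_closed_point[OF E(2,1)] by blast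
    obtain u s where us: "a = (u, s)" by (cases a)
    have sep: "u \<bullet> x + s * y > b" if "f x \<le> ereal y" for x y
      using ab(2)[of "(x, y)"] that by (simp add: us E_def)
    have "s \<ge> 0"
    proof (rule ccontr)
      assume s: "\<not> s \<ge> 0"
      \<comment> \<open>A height in the epigraph over \<open>x1\<close> so large that a negative
        \<open>s\<close> would contradict the separation.\<close>
      define y where "y = max y1 ((b - u \<bullet> x1) / s)"
      have "s * y \<le> s * ((b - u \<bullet> x1) / s)" using s by (intro mult_left_mono_neg) (auto simp: y_def)
      then have "u \<bullet> x1 + s * y \<le> b" using s by simp
      moreover have "u \<bullet> x1 + s * y > b" by (intro sep) (simp add: y1 y_def)
      ultimately show False by simp
    qed
    then show ?thesis using ab(1) sep by (auto simp: us)
  qed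
  have minorant: "\<exists>p. (\<forall>x. ereal (affine_fun p x) \<le> f x) \<and> r < affine_fun p x0"
    if s: "s > 0" and less: "u \<bullet> x0 + s * r < b"
      and sep: "\<And>x y. f x \<le> ereal y \<Longrightarrow> u \<bullet> x + s * y > b" for u s b r x0
  proof -
    define p where "p = ((- 1 / s) *\<^sub>R u, b / s)"
    have p: "affine_fun p x = (b - u \<bullet> x) / s" for x
      by (simp add: p_def affine_fun_def diff_divide_distrib)
    have "ereal (affine_fun p x) \<le> f x" for x
    proof (cases "f x")
      case (real y)
      then show ?thesis using sep[of x y] s by (simp add: p field_simps)
    qed (use f in \<open>auto simp: Conv_def\<close>)
    moreover have "r < affine_fun p x0" using less s by (simp add: p field_simps)
    ultimately show ?thesis by blast
  qed
  \<comment> \<open>A point directly below a finite value cannot be separated by a vertical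
    hyperplane, so a first minorant \<open>p1\<close> exists.\<close>
  have "ereal (y1 - 1) < f x1" by (simp add: y1)
  from sep[OF this] obtain u s b where 1: "u \<bullet> x1 + s * (y1 - 1) < b"
    "\<And>x y. f x \<le> ereal y \<Longrightarrow> u \<bullet> x + s * y > b" "s \<ge> 0" by blast
  have "s > 0" using 1(1) 1(2)[of x1 y1] y1 1(3) by (cases "s = 0") auto
  from minorant[OF this 1(1,2)] obtain p1 where p1: "\<And>x. ereal (affine_fun p1 x) \<le> f x" by blast
  from sep[OF r] obtain u s b where 2: "u \<bullet> x0 + s * r < b"
    "\<And>x y. f x \<le> ereal y \<Longrightarrow> u \<bullet> x + s * y > b" "s \<ge> 0" by blast
  show thesis
  proof (cases "s = 0")
    case False
    then have "s > 0" using 2(3) by simp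
    from minorant[OF this 2(1,2)] that show thesis by blast
  next
    case True
    define \<delta> where "\<delta> = b - u \<bullet> x0"
    have \<delta>: "\<delta> > 0" using 2(1) True by (simp add: \<delta>_def)
    \<comment> \<open>With this multiple the added term equals
      \<open>\<bar>r - affine_fun p1 x0\<bar> + 1\<close> at \<open>x0\<close>, while it is at most
      0 wherever \<open>f\<close> is finite.\<close>
    define t where "t = (\<bar>r - affine_fun p1 x0\<bar> + 1) / \<delta>"
    have t: "t > 0" using \<delta> by (simp add: t_def)
    define p where "p = p1 + t *\<^sub>R (- u, b)"
    have p: "affine_fun p x = affine_fun p1 x + t * (b - u \<bullet> x)" for x
      by (simp add: p_def affine_fun_add affine_fun_scaleR) (simp add: affine_fun_def algebra_simps)
    have "ereal (affine_fun p x) \<le> f x" for x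
    proof (cases "f x")
      case (real y)
      then have "b - u \<bullet> x \<le> 0" using 2(2)[of x y] True by simp
      then have "t * (b - u \<bullet> x) \<le> 0" using t by (simp add: mult_nonneg_nonpos)
      moreover have "affine_fun p1 x \<le> y" using p1[of x] real by simp
      ultimately show ?thesis by (simp add: p real)
    qed (use f in \<open>auto simp: Conv_def\<close>)
    moreover have "t * (b - u \<bullet> x0) = \<bar>r - affine_fun p1 x0\<bar> + 1"
      using \<delta> by (simp add: t_def \<delta>_def[symmetric])
    then have "r < affine_fun p x0" unfolding p by linarith
    ultimately show thesis by (rule that)
  qed
qed

text \<open>By the Lindelof property, countably many affine minorants already have supremum
  \<open>f\<close>. The maxima of the first members of an enumeration, with the value infinity off
  \<open>A\<close>, converge to \<open>f\<close> from below.\<close>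

lemma Conv_piecewise_approx:
  fixes f :: "'a::euclidean_space \<Rightarrow> ereal"
  assumes f: "f \<in> Conv" and A: "edom f \<subseteq> A"
  shows "\<exists>F. (\<forall>j. F j \<in> piecewise) \<and> epi_converges (\<lambda>j. on_domain A (F j)) f"
proof -
  \<comment> \<open>The open strict hypograph of an affine function, in the form to which Lindelof's
    theorem applies.\<close>
  define U where "U p = {z. snd z < fst p \<bullet> fst z + snd p}" for p :: "'a \<times> real"
  define M where "M = {p. \<forall>x. ereal (affine_fun p x) \<le> f x}"
  have "open (U p)" for p
    unfolding U_def by (rule open_Collect_less; intro continuous_intros)
  then have "open X" if "X \<in> U ` M" for X using that by blast
  then obtain C' where C': "C' \<subseteq> U ` M" "countable C'" "\<Union>C' = \<Union>(U ` M)"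
    by (meson Lindelof)
  then have "\<exists>C. countable C \<and> C \<subseteq> M \<and> C' = U ` C"
    using countable_subset_image[of C' U M] by simp
  then obtain C where C: "countable C" "C \<subseteq> M" "C' = U ` C" by blast
  have dense: "\<exists>p\<in>C. r < affine_fun p x" if r: "ereal r < f x" for x r
  proof -
    obtain p where "p \<in> M" "r < affine_fun p x"
      using Conv_affine_minorant[OF f r] unfolding M_def by blast
    then have "(x, r) \<in> \<Union>(U ` M)" by (auto simp: U_def affine_fun_def)
    then have "(x, r) \<in> \<Union>(U ` C)" by (simp only: C'(3)[symmetric] C(3)[symmetric])
    then obtain p' where "p' \<in> C" "(x, r) \<in> U p'" by blast
    then show ?thesis by (auto simp: U_def affine_fun_def)
  qed
  have minor: "ereal (affine_fun p x) \<le> f x" if "p \<in> C" for p x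
    using that C(2) by (auto simp: M_def)
  have "C \<noteq> {}"
  proof -
    have "f 0 \<noteq> -\<infinity>" using f by (simp add: Conv_def)
    then obtain r where "ereal r < f 0" using ereal_dense2[of "-\<infinity>" "f 0"] by auto
    then show ?thesis using dense by blast
  qed
  define S where "S j = from_nat_into C ` {..j}" for j
  have S: "finite (S j)" "S j \<noteq> {}" "S j \<subseteq> C" for j
    using from_nat_into[OF \<open>C \<noteq> {}\<close>] by (auto simp: S_def)
  have ev: "\<forall>\<^sub>F j in sequentially. p \<in> S j" if p: "p \<in> C" for p
  proof -
    obtain i where "from_nat_into C i = p" using from_nat_into_surj[OF C(1) p] by blast
    then have "p \<in> S j" if "j \<ge> i" for j using that by (auto simp: S_def)
    then show ?thesis unfolding eventually_sequentially by blast
  qed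
  \<comment> \<open>A single minorant exceeding \<open>r\<close> at \<open>x\<close> exceeds it near
    \<open>x\<close> by continuity, and it belongs to \<open>S j\<close> for all large
    \<open>j\<close>.\<close>
  have lower: "f x \<le> liminf (\<lambda>j. on_domain A (max_over (S j)) (xs j))" if xs: "xs \<longlonglongrightarrow> x" for xs x
    unfolding le_Liminf_iff
  proof (intro allI impI)
    fix y assume "y < f x"
    then obtain r where r: "y < ereal r" "ereal r < f x" using ereal_dense2 by blast
    obtain p where p: "p \<in> C" "r < affine_fun p x" using dense[OF r(2)] by blast
    have "(\<lambda>j. affine_fun p (xs j)) \<longlonglongrightarrow> affine_fun p x"
      unfolding affine_fun_def by (intro tendsto_intros xs)
    then have "\<forall>\<^sub>F j in sequentially. r < affine_fun p (xs j)"
      using p(2) by (rule order_tendstoD)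
    with ev[OF p(1)] show "\<forall>\<^sub>F j in sequentially. y < on_domain A (max_over (S j)) (xs j)"
    proof eventually_elim
      case (elim j)
      then have "r < max_over (S j) (xs j)" using max_over_ge[OF S(1) elim(1)] by (meson less_le_trans)
      then have "ereal r < on_domain A (max_over (S j)) (xs j)" by (simp add: on_domain_simps)
      then show ?case using r(1) by (rule less_trans[rotated])
    qed
  qed
  have upper: "on_domain A (max_over (S j)) x \<le> f x" for j x
  proof (cases "x \<in> A")
    case True
    have "max_over (S j) x \<in> (\<lambda>p. affine_fun p x) ` S j"
      unfolding max_over_def using S by (intro Max_in) auto
    then show ?thesis using True minor S(3)[of j] by (auto simp: on_domain_simps)
  next
    case False
    then have "x \<notin> edom f" using A by blast
    then show ?thesis by (simp add: edom_def)
  qed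
  \<comment> \<open>The convergence is also pointwise, so constant sequences serve as recovery
    sequences.\<close>
  have "(\<lambda>j. on_domain A (max_over (S j)) x) \<longlonglongrightarrow> f x" for x
  proof (rule order_tendstoI)
    fix a assume "a < f x"
    then show "\<forall>\<^sub>F j in sequentially. a < on_domain A (max_over (S j)) x"
      using lower[OF tendsto_const] by (simp add: le_Liminf_iff)
  next
    fix a assume "f x < a"
    then show "\<forall>\<^sub>F j in sequentially. on_domain A (max_over (S j)) x < a"
      by (intro always_eventually allI le_less_trans[OF upper])
  qed
  then have "\<exists>xs. xs \<longlonglongrightarrow> x \<and> (\<lambda>j. on_domain A (max_over (S j)) (xs j)) \<longlonglongrightarrow> f x" for x
    using tendsto_const[of x sequentially] by blast
  then have "epi_converges (\<lambda>j. on_domain A (max_over (S j))) f"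
    unfolding epi_converges_def using lower by blast
  moreover have "\<forall>j. max_over (S j) \<in> piecewise"
    using S by (intro allI max_affine_piecewise[OF max_affine_max_over])
  ultimately show ?thesis by (intro exI[of _ "\<lambda>j. max_over (S j)"] conjI)
qed

text \<open>The factor may vary with \<open>j\<close>, because a real dilation factor is later
  approximated by rationals together with the function. A positive limit keeps products of 0 and
  infinity out of the limit.\<close>

lemma epi_converges_scale:
  fixes s :: "nat \<Rightarrow> real"
  assumes F: "epi_converges F f" and s: "s \<longlonglongrightarrow> t" "t > 0"
  shows "epi_converges (\<lambda>j x. ereal (s j) * F j x) (\<lambda>x. ereal t * f x)"
  unfolding epi_converges_def
proof (intro allI conjI impI)
  have s': "(\<lambda>j. ereal (s j)) \<longlonglongrightarrow> ereal t" using s(1) by simp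
  fix x
  show "ereal t * f x \<le> liminf (\<lambda>j. ereal (s j) * F j (xs j))" if "xs \<longlonglongrightarrow> x" for xs
  proof -
    have "f x \<le> liminf (\<lambda>j. F j (xs j))" using F that unfolding epi_converges_def by blast
    then have "ereal t * f x \<le> ereal t * liminf (\<lambda>j. F j (xs j))"
      using s(2) by (intro ereal_mult_left_mono) auto
    then show ?thesis using ereal_liminf_lim_mult[OF s'] s(2) by simp
  qed
  obtain xs where xs: "xs \<longlonglongrightarrow> x" "(\<lambda>j. F j (xs j)) \<longlonglongrightarrow> f x"
    using F unfolding epi_converges_def by meson
  have "(\<lambda>j. ereal (s j) * F j (xs j)) \<longlonglongrightarrow> ereal t * f x"
    using s(2) by (intro tendsto_mult_ereal s' xs(2)) auto
  with xs(1) show "\<exists>xs. xs \<longlonglongrightarrow> x \<and> (\<lambda>j. ereal (s j) * F j (xs j)) \<longlonglongrightarrow> ereal t * f x"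
    by blast
qed

section \<open>The homogeneous decomposition\<close>

lemma tendsto_scaleR_tvs:
  fixes g :: "'b \<Rightarrow> 'v::real_tvs"
  assumes "(f \<longlongrightarrow> a) F" "(g \<longlongrightarrow> x) F"
  shows "((\<lambda>y. f y *\<^sub>R g y) \<longlongrightarrow> a *\<^sub>R x) F"
  using filterlim_compose[OF tendsto_scaleR_Pair filterlim_Pair[OF assms]] by simp

text \<open>Interchanging the sums leaves the scalar identity for the weights. This is what
  determines coefficients, both for homogeneity and for uniqueness.\<close>

lemma weights_extract:
  fixes v :: "nat \<Rightarrow> 'v::real_vector"
  assumes w: "\<And>k l. l \<le> N \<Longrightarrow> (\<Sum>i = 1..Suc N. w k i * real i ^ l) = (if k = l then 1 else 0)"
    and k: "k \<le> N"
  shows "(\<Sum>i = 1..Suc N. w k i *\<^sub>R (\<Sum>l\<le>N. real i ^ l *\<^sub>R v l)) = v k"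
proof -
  have "(\<Sum>i = 1..Suc N. w k i *\<^sub>R (\<Sum>l\<le>N. real i ^ l *\<^sub>R v l))
      = (\<Sum>l\<le>N. (\<Sum>i = 1..Suc N. w k i * real i ^ l) *\<^sub>R v l)"
    by (simp only: scaleR_sum_right scaleR_sum_left scaleR_scaleR) (rule sum.swap)
  also have "\<dots> = (\<Sum>l\<le>N. if k = l then v l else 0)"
    by (intro sum.cong refl) (use w in simp)
  also have "\<dots> = v k" using k by simp
  finally show ?thesis .
qed

lemma polynomial_deg_le_sum:
  assumes "\<And>i. i \<in> I \<Longrightarrow> polynomial_deg_le d (P i)"
  shows "polynomial_deg_le d (\<lambda>x. \<Sum>i\<in>I. w i *\<^sub>R P i x)"
proof -
  from assms have "\<forall>i\<in>I. \<exists>c. \<forall>x. P i x = (\<Sum>\<alpha>\<in>exponents_le d. (\<Prod>b\<in>Basis. (x \<bullet> b) ^ \<alpha> b) *\<^sub>R c \<alpha>)"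
    unfolding polynomial_deg_le_def by blast
  from bchoice[OF this] obtain c where
    c: "\<And>i x. i \<in> I \<Longrightarrow> P i x = (\<Sum>\<alpha>\<in>exponents_le d. (\<Prod>b\<in>Basis. (x \<bullet> b) ^ \<alpha> b) *\<^sub>R c i \<alpha>)" by blast
  have "(\<Sum>i\<in>I. w i *\<^sub>R P i x) = (\<Sum>\<alpha>\<in>exponents_le d. (\<Prod>b\<in>Basis. (x \<bullet> b) ^ \<alpha> b) *\<^sub>R (\<Sum>i\<in>I. w i *\<^sub>R c i \<alpha>))" for x
  proof -
    have "(\<Sum>i\<in>I. w i *\<^sub>R P i x)
        = (\<Sum>i\<in>I. \<Sum>\<alpha>\<in>exponents_le d. (\<Prod>b\<in>Basis. (x \<bullet> b) ^ \<alpha> b) *\<^sub>R w i *\<^sub>R c i \<alpha>)"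
      by (intro sum.cong refl) (simp add: c scaleR_sum_right mult.commute)
    also have "\<dots> = (\<Sum>\<alpha>\<in>exponents_le d. \<Sum>i\<in>I. (\<Prod>b\<in>Basis. (x \<bullet> b) ^ \<alpha> b) *\<^sub>R w i *\<^sub>R c i \<alpha>)"
      by (rule sum.swap)
    finally show ?thesis by (simp only: scaleR_sum_right)
  qed
  then show ?thesis
    unfolding polynomial_deg_le_def by (intro exI[of _ "\<lambda>\<alpha>. \<Sum>i\<in>I. w i *\<^sub>R c i \<alpha>"]) blast
qed

lemma polynomial_deg_le_dilation:
  assumes "polynomial_deg_le d P"
  shows "polynomial_deg_le d (\<lambda>x. P (t *\<^sub>R x))"
proof -
  obtain c where c: "\<And>x. P x = (\<Sum>\<alpha>\<in>exponents_le d. (\<Prod>b\<in>Basis. (x \<bullet> b) ^ \<alpha> b) *\<^sub>R c \<alpha>)"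
    using assms unfolding polynomial_deg_le_def by blast
  have "P (t *\<^sub>R x) = (\<Sum>\<alpha>\<in>exponents_le d. (\<Prod>b\<in>Basis. (x \<bullet> b) ^ \<alpha> b) *\<^sub>R (\<Prod>b\<in>Basis. t ^ \<alpha> b) *\<^sub>R c \<alpha>)" for x
    unfolding c by (intro sum.cong refl) (simp add: power_mult_distrib prod.distrib mult.commute)
  then show ?thesis
    unfolding polynomial_deg_le_def by (intro exI[of _ "\<lambda>\<alpha>. (\<Prod>b\<in>Basis. t ^ \<alpha> b) *\<^sub>R c \<alpha>"]) blast
qed

section \<open>Expansion of dilations, first for piecewise affine functions and then by
  continuity\<close>

lemma valuation_on_piecewise:
  fixes Z :: "('a::euclidean_space \<Rightarrow> ereal) \<Rightarrow> 'v::ab_group_add"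
  assumes cone: "AO_cone \<A> \<O> \<Gamma>" and Z: "valuation_on \<Gamma> Z"
  shows "piecewise_valuation (\<lambda>F. Z (on_domain \<A> F))"
  unfolding piecewise_valuation_def
proof (intro ballI impI)
  fix F G :: "'a \<Rightarrow> real"
  assume FG: "F \<in> piecewise" "G \<in> piecewise" "(\<lambda>x. min (F x) (G x)) \<in> piecewise"
  have max: "on_domain \<A> (\<lambda>x. max (F x) (G x)) = (\<lambda>x. max (on_domain \<A> F x) (on_domain \<A> G x))"
    and min: "on_domain \<A> (\<lambda>x. min (F x) (G x)) = (\<lambda>x. min (on_domain \<A> F x) (on_domain \<A> G x))"
    by (auto simp: on_domain_simps fun_eq_iff max_def min_def)
  have "on_domain \<A> F \<in> \<Gamma>" "on_domain \<A> G \<in> \<Gamma>"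
    "(\<lambda>x. max (on_domain \<A> F x) (on_domain \<A> G x)) \<in> \<Gamma>" "(\<lambda>x. min (on_domain \<A> F x) (on_domain \<A> G x)) \<in> \<Gamma>"
    unfolding max[symmetric] min[symmetric] by (intro on_domain_in_cone[OF cone] piecewise_max FG)+
  then show "Z (on_domain \<A> (\<lambda>x. max (F x) (G x))) + Z (on_domain \<A> (\<lambda>x. min (F x) (G x)))
      = Z (on_domain \<A> F) + Z (on_domain \<A> G)"
    using Z unfolding max min valuation_on_def by blast
qed

lemma polynomial_on_piecewise:
  fixes Z :: "('a::euclidean_space \<Rightarrow> ereal) \<Rightarrow> 'v::real_vector"
  assumes cone: "AO_cone \<A> \<O> \<Gamma>" and Z: "polynomial_on d \<Gamma> Z"
  shows "translation_deg_less (Suc d) (\<lambda>F. Z (on_domain \<A> F))"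
proof (rule translation_deg_lessI)
  fix F :: "'a \<Rightarrow> real" assume "F \<in> piecewise"
  from on_domain_in_cone[OF cone this]
  have "polynomial_deg_le d (\<lambda>(a, b). Z (\<lambda>x. on_domain \<A> F x + ereal (a \<bullet> x + b)))"
    using Z unfolding polynomial_on_def by (rule bspec[rotated])
  moreover have "(\<lambda>x. on_domain \<A> F x + ereal (fst p \<bullet> x + snd p)) = on_domain \<A> (\<lambda>x. F x + affine_fun p x)" for p
    by (rule ext) (simp add: on_domain_simps affine_fun_def)
  ultimately have "polynomial_deg_le d (\<lambda>p. Z (on_domain \<A> (\<lambda>x. F x + affine_fun p x)))"
    by (simp only: split_def)
  then show "diff_deg_less (Suc d) (\<lambda>p. Z (on_domain \<A> (\<lambda>x. F x + affine_fun p x)))"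
    by (rule polynomial_imp_diff_deg_less)
qed

lemma rational_approx:
  fixes t :: real
  assumes "t > 0"
  shows "\<exists>a. (\<forall>j. a j > 0) \<and> (\<lambda>j. real (a j) / real (Suc j)) \<longlonglongrightarrow> t"
proof -
  \<comment> \<open>Rounding down and adding one keeps the numerators positive.\<close>
  define a where "a j = Suc (nat \<lfloor>t * real (Suc j)\<rfloor>)" for j
  have pos: "\<forall>j. a j > 0" by (simp add: a_def)
  have bounds: "t \<le> real (a j) / real (Suc j)" "real (a j) / real (Suc j) \<le> t + inverse (real (Suc j))" for j
  proof -
    have a: "real (a j) = of_int \<lfloor>t * real (Suc j)\<rfloor> + 1" using assms by (simp add: a_def)
    have pos: "real (Suc j) > 0" by simp
    have "t * real (Suc j) \<le> real (a j)" unfolding a by linarith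
    then show "t \<le> real (a j) / real (Suc j)" by (simp only: pos_le_divide_eq[OF pos])
    have "real (a j) \<le> t * real (Suc j) + 1" unfolding a by linarith
    also have "\<dots> = (t + inverse (real (Suc j))) * real (Suc j)"
      using pos by (simp add: distrib_right del: of_nat_Suc)
    finally show "real (a j) / real (Suc j) \<le> t + inverse (real (Suc j))"
      by (simp only: pos_divide_le_eq[OF pos])
  qed
  have "(\<lambda>j. t + inverse (real (Suc j))) \<longlonglongrightarrow> t"
    by (rule LIMSEQ_inverse_real_of_nat_add)
  then have "(\<lambda>j. real (a j) / real (Suc j)) \<longlonglongrightarrow> t"
    by (rule tendsto_sandwich[OF _ _ tendsto_const, rotated 2]) (intro always_eventually allI bounds)+
  with pos show ?thesis by blast
qed

text \<open>The polynomial bound for integer multiples is applied to \<open>F / b\<close>, whose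
  \<open>a\<close>-fold multiple is the function in question.\<close>

lemma piecewise_expansion_rational:
  fixes Y :: "('a::euclidean_space \<Rightarrow> real) \<Rightarrow> 'v::real_vector"
  assumes Y: "piecewise_valuation Y" "translation_deg_less (Suc d) Y" and F: "F \<in> piecewise"
    and N: "N = DIM('a) + d"
    and w: "\<And>k l. l \<le> N \<Longrightarrow> (\<Sum>i = 1..Suc N. w k i * real i ^ l) = (if k = l then 1 else 0)"
    and b: "b > 0"
  shows "Y (\<lambda>x. (real a / real b) * F x)
    = (\<Sum>k\<le>N. (real a / real b) ^ k *\<^sub>R (\<Sum>i = 1..Suc N. w k i *\<^sub>R Y (\<lambda>x. real i * F x)))"
proof -
  have "(\<lambda>x. (1 / real b) * F x) \<in> piecewise" using F by (intro piecewise_scale) auto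
  then obtain S where S: "finite S" "S \<noteq> {}" "(\<lambda>x. (1 / real b) * F x) = max_over S"
    unfolding piecewise_def using max_affine_imp_max_over by blast
  define D where "D m = Y (\<lambda>x. real m * max_over S x)" for m
  have D: "Y (\<lambda>x. (real m / real b) * F x) = D m" for m
    by (simp add: D_def S(3)[symmetric])
  have "seq_deg_less (DIM('a) + Suc d) D"
    unfolding D_def by (intro seq_deg_less_max_over Y S)
  then obtain c where c: "\<And>m. D m = (\<Sum>k<DIM('a) + Suc d. real m ^ k *\<^sub>R c k)"
    using seq_deg_less_powers by blast
  have c: "D m = (\<Sum>k\<le>N. real m ^ k *\<^sub>R c k)" for m
    by (simp add: c N lessThan_Suc_atMost)
  \<comment> \<open>\<open>i F\<close> is the \<open>i * b\<close>-fold multiple of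
    \<open>F / b\<close>, so the weights return \<open>real b ^ k *\<^sub>R c k\<close>, and the
    powers of \<open>b\<close> cancel in the expansion.\<close>
  have "Y (\<lambda>x. real i * F x) = (\<Sum>l\<le>N. real i ^ l *\<^sub>R (real b ^ l *\<^sub>R c l))" for i
    using D[of "i * b"] b by (simp add: c power_mult_distrib)
  then have "(\<Sum>i = 1..Suc N. w k i *\<^sub>R Y (\<lambda>x. real i * F x)) = real b ^ k *\<^sub>R c k" if "k \<le> N" for k
    using weights_extract[OF w that, of "\<lambda>l. real b ^ l *\<^sub>R c l"] by simp
  then have "(\<Sum>k\<le>N. (real a / real b) ^ k *\<^sub>R (\<Sum>i = 1..Suc N. w k i *\<^sub>R Y (\<lambda>x. real i * F x)))
      = (\<Sum>k\<le>N. real a ^ k *\<^sub>R c k)"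
    using b by (intro sum.cong refl) (simp add: power_divide)
  then show ?thesis by (simp only: D c)
qed

lemma PV_tendsto:
  fixes Z :: "('a::euclidean_space \<Rightarrow> ereal) \<Rightarrow> 'v::real_tvs"
  assumes \<Gamma>: "\<Gamma> \<subseteq> Conv" and Z: "Z \<in> PV d \<Gamma>"
    and "\<And>j. G j \<in> \<Gamma>" "g \<in> \<Gamma>" "epi_converges G g"
  shows "(\<lambda>j. Z (G j)) \<longlonglongrightarrow> Z g"
proof -
  have "continuous_map (subtopology epi_topology \<Gamma>) euclidean Z" using Z by (simp add: PV_def)
  then have "\<forall>F f. range F \<subseteq> \<Gamma> \<and> f \<in> \<Gamma> \<and> epi_converges F f \<longrightarrow> (\<lambda>j. Z (F j)) \<longlonglongrightarrow> Z f"
    by (simp only: continuous_map_epi_topology[OF \<Gamma>])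
  from this[rule_format, of G g] assms show ?thesis by (simp add: image_subset_iff)
qed

lemma AO_coneD:
  assumes "AO_cone \<A> \<O> \<Gamma>"
  shows "\<Gamma> \<subseteq> Conv" "f \<in> \<Gamma> \<Longrightarrow> edom f \<subseteq> \<A>"
    "f \<in> \<Gamma> \<Longrightarrow> t > 0 \<Longrightarrow> (\<lambda>x. ereal t * f x) \<in> \<Gamma>"
    "f \<in> \<Gamma> \<Longrightarrow> g \<in> \<Gamma> \<Longrightarrow> (\<lambda>x. f x + g x) \<in> \<Gamma>"
  using assms unfolding AO_cone_def by simp_all

lemma PV_tendsto_scale:
  fixes Z :: "('a::euclidean_space \<Rightarrow> ereal) \<Rightarrow> 'v::real_tvs"
  assumes cone: "AO_cone \<A> \<O> \<Gamma>" and Z: "Z \<in> PV d \<Gamma>"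
    and G: "\<And>j. G j \<in> \<Gamma>" "g \<in> \<Gamma>" "epi_converges G g"
    and s: "\<And>j. s j > 0" "s \<longlonglongrightarrow> t" "t > 0"
  shows "(\<lambda>j. Z (\<lambda>x. ereal (s j) * G j x)) \<longlonglongrightarrow> Z (\<lambda>x. ereal t * g x)"
proof (rule PV_tendsto[OF AO_coneD(1)[OF cone] Z])
  show "(\<lambda>x. ereal (s j) * G j x) \<in> \<Gamma>" for j by (rule AO_coneD(3)[OF cone G(1) s(1)])
  show "(\<lambda>x. ereal t * g x) \<in> \<Gamma>" by (rule AO_coneD(3)[OF cone G(2) s(3)])
  show "epi_converges (\<lambda>j x. ereal (s j) * G j x) (\<lambda>x. ereal t * g x)"
    by (rule epi_converges_scale[OF G(3) s(2,3)])
qed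

lemma PV_dilation_sum_tendsto:
  fixes Z :: "('a::euclidean_space \<Rightarrow> ereal) \<Rightarrow> 'v::real_tvs"
  assumes cone: "AO_cone \<A> \<O> \<Gamma>" and Z: "Z \<in> PV d \<Gamma>"
    and G: "\<And>j. G j \<in> \<Gamma>" "g \<in> \<Gamma>" "epi_converges G g" and s: "\<And>i. i \<in> I \<Longrightarrow> s i > 0"
  shows "(\<lambda>j. \<Sum>i\<in>I. w i *\<^sub>R Z (\<lambda>x. ereal (s i) * G j x)) \<longlonglongrightarrow> (\<Sum>i\<in>I. w i *\<^sub>R Z (\<lambda>x. ereal (s i) * g x))"
proof (rule tendsto_sum)
  fix i assume i: "i \<in> I"
  show "(\<lambda>j. w i *\<^sub>R Z (\<lambda>x. ereal (s i) * G j x)) \<longlonglongrightarrow> w i *\<^sub>R Z (\<lambda>x. ereal (s i) * g x)"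
    using PV_tendsto_scale[OF cone Z G s[OF i] tendsto_const s[OF i]]
    by (rule tendsto_scaleR_tvs[OF tendsto_const])
qed

text \<open>\<open>f\<close> is approximated by piecewise affine functions and \<open>t\<close> by
  rationals at the same time. Both sides of the rational expansion converge, and in a Hausdorff
  space the limits agree.\<close>

lemma PV_expansion:
  fixes Z :: "('a::euclidean_space \<Rightarrow> ereal) \<Rightarrow> 'v::{real_tvs, t2_space}"
  assumes cone: "AO_cone \<A> \<O> \<Gamma>" and Z: "Z \<in> PV d \<Gamma>" and N: "N = DIM('a) + d"
    and w: "\<And>k l. l \<le> N \<Longrightarrow> (\<Sum>i = 1..Suc N. w k i * real i ^ l) = (if k = l then 1 else 0)"
    and f: "f \<in> \<Gamma>" and t: "t > 0"
  shows "Z (\<lambda>x. ereal t * f x)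
    = (\<Sum>k\<le>N. t ^ k *\<^sub>R (\<Sum>i = 1..Suc N. w k i *\<^sub>R Z (\<lambda>x. ereal (real i) * f x)))"
proof -
  define Y where "Y F = Z (on_domain \<A> F)" for F
  have "valuation_on \<Gamma> Z" "polynomial_on d \<Gamma> Z" using Z by (simp_all add: PV_def)
  then have Y: "piecewise_valuation Y" "translation_deg_less (Suc d) Y"
    unfolding Y_def by (auto intro: valuation_on_piecewise[OF cone] polynomial_on_piecewise[OF cone] simp del: translation_deg_less.simps)
  obtain F where F: "\<And>j. F j \<in> piecewise" "epi_converges (\<lambda>j. on_domain \<A> (F j)) f"
    using Conv_piecewise_approx[OF subsetD[OF AO_coneD(1)[OF cone] f] AO_coneD(2)[OF cone f]] by blast
  obtain a where a: "\<And>j. a j > 0" "(\<lambda>j. real (a j) / real (Suc j)) \<longlonglongrightarrow> t"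
    using rational_approx[OF t] by blast
  define r where "r j = real (a j) / real (Suc j)" for j
  have r: "r j > 0" "r \<longlonglongrightarrow> t" for j using a by (simp_all add: r_def[abs_def] del: of_nat_Suc)
  have in\<Gamma>: "on_domain \<A> (F j) \<in> \<Gamma>" for j using F by (intro on_domain_in_cone[OF cone])
  have "(\<lambda>j. Z (\<lambda>x. ereal (r j) * on_domain \<A> (F j) x)) \<longlonglongrightarrow> Z (\<lambda>x. ereal t * f x)"
    by (rule PV_tendsto_scale[OF cone Z in\<Gamma> f F(2) r t])
  moreover have "Z (\<lambda>x. ereal (r j) * on_domain \<A> (F j) x)
      = (\<Sum>k\<le>N. r j ^ k *\<^sub>R (\<Sum>i = 1..Suc N. w k i *\<^sub>R Z (\<lambda>x. ereal (real i) * on_domain \<A> (F j) x)))" for j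
  proof -
    have "Z (\<lambda>x. ereal (r j) * on_domain \<A> (F j) x) = Y (\<lambda>x. r j * F j x)"
      using r by (simp add: Y_def on_domain_scale)
    also have "\<dots> = (\<Sum>k\<le>N. r j ^ k *\<^sub>R (\<Sum>i = 1..Suc N. w k i *\<^sub>R Y (\<lambda>x. real i * F j x)))"
      unfolding r_def by (intro piecewise_expansion_rational[OF Y F(1) N w]) auto
    also have "\<dots> = (\<Sum>k\<le>N. r j ^ k *\<^sub>R (\<Sum>i = 1..Suc N. w k i *\<^sub>R Z (\<lambda>x. ereal (real i) * on_domain \<A> (F j) x)))"
      by (intro sum.cong refl arg_cong2[where f = scaleR]) (simp_all add: Y_def on_domain_scale)
    finally show ?thesis .
  qed
  moreover have "(\<lambda>j. \<Sum>k\<le>N. r j ^ k *\<^sub>R (\<Sum>i = 1..Suc N. w k i *\<^sub>R Z (\<lambda>x. ereal (real i) * on_domain \<A> (F j) x)))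
      \<longlonglongrightarrow> (\<Sum>k\<le>N. t ^ k *\<^sub>R (\<Sum>i = 1..Suc N. w k i *\<^sub>R Z (\<lambda>x. ereal (real i) * f x)))"
    by (intro tendsto_sum[OF tendsto_scaleR_tvs[OF tendsto_power[OF r(2)]]]
        PV_dilation_sum_tendsto[OF cone Z in\<Gamma> f F(2)]) simp
  ultimately show ?thesis by (simp only: LIMSEQ_unique)
qed

text \<open>Positive dilations preserve the cone and epi-convergence and commute with maxima and
  minima. A translation of \<open>f\<close> by \<open>p\<close> becomes a translation of
  \<open>s f\<close> by \<open>s p\<close>, so the polynomial degree is kept as well.\<close>

lemma PV_dilation_sum:
  fixes Z :: "('a::euclidean_space \<Rightarrow> ereal) \<Rightarrow> 'v::real_tvs"
  assumes cone: "AO_cone \<A> \<O> \<Gamma>" and Z: "Z \<in> PV d \<Gamma>" and I: "\<And>i. i \<in> I \<Longrightarrow> s i > 0"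
  shows "restrict (\<lambda>f. \<Sum>i\<in>I. w i *\<^sub>R Z (\<lambda>x. ereal (s i) * f x)) \<Gamma> \<in> PV d \<Gamma>"
    (is "restrict ?W \<Gamma> \<in> _")
proof -
  have Zv: "valuation_on \<Gamma> Z" and Zp: "polynomial_on d \<Gamma> Z" using Z by (simp_all add: PV_def)
  note \<Gamma> = AO_coneD(1)[OF cone] and scale = AO_coneD(3)[OF cone] and add = AO_coneD(4)[OF cone]
    and dom = AO_coneD(2)[OF cone]
  have "(\<lambda>j. restrict ?W \<Gamma> (G j)) \<longlonglongrightarrow> restrict ?W \<Gamma> g"
    if "range G \<subseteq> \<Gamma>" "g \<in> \<Gamma>" "epi_converges G g" for G g
  proof -
    have G: "G j \<in> \<Gamma>" for j using that(1) by blast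
    have "(\<lambda>j. ?W (G j)) \<longlonglongrightarrow> ?W g"
      by (rule PV_dilation_sum_tendsto[OF cone Z G that(2,3) I])
    then show ?thesis using G that(2) by simp
  qed
  then have 1: "continuous_map (subtopology epi_topology \<Gamma>) euclidean (restrict ?W \<Gamma>)"
    by (subst continuous_map_epi_topology[OF \<Gamma>]) blast
  have 2: "valuation_on \<Gamma> (restrict ?W \<Gamma>)"
    unfolding valuation_on_def
  proof (intro allI impI)
    fix f h
    assume fh: "f \<in> \<Gamma> \<and> h \<in> \<Gamma> \<and> (\<lambda>x. max (f x) (h x)) \<in> \<Gamma> \<and> (\<lambda>x. min (f x) (h x)) \<in> \<Gamma>"
    have "Z (\<lambda>x. ereal t * max (f x) (h x)) + Z (\<lambda>x. ereal t * min (f x) (h x))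
        = Z (\<lambda>x. ereal t * f x) + Z (\<lambda>x. ereal t * h x)" if t: "t > 0" for t
    proof -
      have max: "ereal t * max (f x) (h x) = max (ereal t * f x) (ereal t * h x)"
        and min: "ereal t * min (f x) (h x) = min (ereal t * f x) (ereal t * h x)" for x
        using t by (auto simp: max_def min_def ereal_mult_le_mult_iff)
      have "(\<lambda>x. max (ereal t * f x) (ereal t * h x)) \<in> \<Gamma>" "(\<lambda>x. min (ereal t * f x) (ereal t * h x)) \<in> \<Gamma>"
        unfolding max[symmetric] min[symmetric] using fh t by (auto intro: scale)
      then show ?thesis
        unfolding max min
        using Zv[unfolded valuation_on_def, rule_format, of "\<lambda>x. ereal t * f x" "\<lambda>x. ereal t * h x"] fh scale[OF _ t]
        by blast
    qed
    then show "restrict ?W \<Gamma> (\<lambda>x. max (f x) (h x)) + restrict ?W \<Gamma> (\<lambda>x. min (f x) (h x))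
        = restrict ?W \<Gamma> f + restrict ?W \<Gamma> h"
      using fh I by (simp add: sum.distrib[symmetric] scaleR_add_right[symmetric] del: scaleR_add_right)
  qed
  have 3: "polynomial_on d \<Gamma> (restrict ?W \<Gamma>)"
    unfolding polynomial_on_def
  proof
    fix f assume f: "f \<in> \<Gamma>"
    \<comment> \<open>An affine function restricted to \<open>\<A>\<close> lies in the cone, and off
      \<open>\<A>\<close> the sum is infinite because \<open>f\<close> is.\<close>
    have mem: "(\<lambda>x. f x + ereal (a \<bullet> x + b)) \<in> \<Gamma>" for a b
    proof -
      have "(\<lambda>x. f x + on_domain \<A> (affine_fun (a, b)) x) \<in> \<Gamma>"
        by (intro add f on_domain_in_cone[OF cone] affine_fun_piecewise)
      moreover have "f x + on_domain \<A> (affine_fun (a, b)) x = f x + ereal (a \<bullet> x + b)" for x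
      proof (cases "x \<in> \<A>")
        case False
        then have "x \<notin> edom f" using dom[OF f] by blast
        then show ?thesis by (simp add: edom_def)
      qed (simp add: on_domain_simps affine_fun_def)
      ultimately show ?thesis by simp
    qed
    have "polynomial_deg_le d (\<lambda>p. Z (\<lambda>x. ereal (s i) * f x + ereal (fst (s i *\<^sub>R p) \<bullet> x + snd (s i *\<^sub>R p))))"
      if i: "i \<in> I" for i
    proof -
      have "polynomial_deg_le d (\<lambda>(a, b). Z (\<lambda>x. ereal (s i) * f x + ereal (a \<bullet> x + b)))"
        using bspec[OF Zp[unfolded polynomial_on_def] scale[OF f I[OF i]]] .
      from polynomial_deg_le_dilation[OF this, of "s i"] show ?thesis by (simp only: split_def)
    qed
    then have "polynomial_deg_le d (\<lambda>p. \<Sum>i\<in>I. w i *\<^sub>R Z (\<lambda>x. ereal (s i) * f x + ereal (fst (s i *\<^sub>R p) \<bullet> x + snd (s i *\<^sub>R p))))"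
      by (rule polynomial_deg_le_sum)
    moreover have "ereal (s i) * f x + ereal (fst (s i *\<^sub>R p) \<bullet> x + snd (s i *\<^sub>R p))
        = ereal (s i) * (f x + ereal (fst p \<bullet> x + snd p))" if "i \<in> I" for i p x
      using I[OF that] by (cases "f x") (simp_all add: algebra_simps)
    ultimately show "polynomial_deg_le d (\<lambda>(a, b). restrict ?W \<Gamma> (\<lambda>x. f x + ereal (a \<bullet> x + b)))"
      using mem by (simp add: split_def)
  qed
  show ?thesis using 1 2 3 by (simp add: PV_def)
qed

section \<open>Existence and uniqueness of the homogeneous components\<close>

theorem theorem1p3:
  fixes \<A> \<O> :: "(real ^ 'n) set"
    and \<Gamma> :: "(real ^ 'n \<Rightarrow> ereal) set"
    and Z :: "(real ^ 'n \<Rightarrow> ereal) \<Rightarrow> 'v::{real_tvs, t2_space}"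
    and d :: nat
  assumes "\<O> \<subseteq> \<A>"
    and "closed \<A>" "convex \<A>" "interior \<A> \<noteq> {}"
    and "closed \<O>" "convex \<O>" "interior \<O> \<noteq> {}"
    and "AO_cone \<A> \<O> \<Gamma>"
    and "Z \<in> PV d \<Gamma>"
  shows "\<exists>!W. W \<in> (\<Pi>\<^sub>E k\<in>{0..CARD('n) + d}. {Y \<in> PV d \<Gamma>. homogeneous_on k \<Gamma> Y}) \<and>
              (\<forall>f\<in>\<Gamma>. Z f = (\<Sum>k=0..CARD('n) + d. W k f))"
proof -
  note cone = \<open>AO_cone \<A> \<O> \<Gamma>\<close> and Z = \<open>Z \<in> PV d \<Gamma>\<close>
  define N where "N = CARD('n) + d"
  have N: "N = DIM(real ^ 'n) + d" by (simp add: N_def)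
  obtain w where w: "\<And>k l. l \<le> N \<Longrightarrow> (\<Sum>i = 1..Suc N. w k i * real i ^ l) = (if k = l then 1 else (0::real))"
    using Lagrange_weights[of N] by blast
  have scale: "\<And>f t. f \<in> \<Gamma> \<Longrightarrow> t > 0 \<Longrightarrow> (\<lambda>x. ereal t * f x) \<in> \<Gamma>"
    using cone unfolding AO_cone_def by blast
  \<comment> \<open>The coefficient of \<open>t ^ k\<close> in \<open>Z (t f)\<close>, read off from
    the values at 1, ..., \<open>Suc N\<close>.\<close>
  define W where "W k f = (\<Sum>i = 1..Suc N. w k i *\<^sub>R Z (\<lambda>x. ereal (real i) * f x))" for k f
  have expansion: "Z (\<lambda>x. ereal t * f x) = (\<Sum>k\<le>N. t ^ k *\<^sub>R W k f)" if "f \<in> \<Gamma>" "t > 0" for f t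
    unfolding W_def by (rule PV_expansion[OF cone Z N w that])
  have W_PV: "restrict (W k) \<Gamma> \<in> PV d \<Gamma>" for k
    unfolding W_def by (intro PV_dilation_sum[OF cone Z]) simp
  \<comment> \<open>Expanding \<open>Z\<close> at \<open>i * t\<close> shows that \<open>t f\<close>
    has the coefficients \<open>t ^ l *\<^sub>R W l f\<close>, which the weights recover.\<close>
  have W_hom: "W k (\<lambda>x. ereal t * f x) = t ^ k *\<^sub>R W k f" if "k \<le> N" "f \<in> \<Gamma>" "t > 0" for k t f
  proof -
    have "Z (\<lambda>x. ereal (real i) * (ereal t * f x)) = (\<Sum>l\<le>N. real i ^ l *\<^sub>R (t ^ l *\<^sub>R W l f))"
      if "i \<in> {1..Suc N}" for i
      using expansion[OF \<open>f \<in> \<Gamma>\<close>, of "real i * t"] \<open>t > 0\<close> that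
      by (simp add: power_mult_distrib mult.assoc[symmetric] flip: times_ereal.simps(1))
    then have "W k (\<lambda>x. ereal t * f x) = (\<Sum>i = 1..Suc N. w k i *\<^sub>R (\<Sum>l\<le>N. real i ^ l *\<^sub>R (t ^ l *\<^sub>R W l f)))"
      unfolding W_def[of k "\<lambda>x. ereal t * f x"] by (intro sum.cong refl) simp
    also have "\<dots> = t ^ k *\<^sub>R W k f" by (rule weights_extract[OF w \<open>k \<le> N\<close>])
    finally show ?thesis .
  qed
  have "(\<lambda>k\<in>{0..N}. restrict (W k) \<Gamma>) \<in> (\<Pi>\<^sub>E k\<in>{0..N}. {Y \<in> PV d \<Gamma>. homogeneous_on k \<Gamma> Y})"
    using W_PV W_hom scale by (auto simp: homogeneous_on_def)
  moreover have "Z f = (\<Sum>k=0..N. (\<lambda>k\<in>{0..N}. restrict (W k) \<Gamma>) k f)" if "f \<in> \<Gamma>" for f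
    using expansion[OF that, of 1] that by (simp add: atLeast0AtMost)
  moreover have "V = (\<lambda>k\<in>{0..N}. restrict (W k) \<Gamma>)"
    if V: "V \<in> (\<Pi>\<^sub>E k\<in>{0..N}. {Y \<in> PV d \<Gamma>. homogeneous_on k \<Gamma> Y})"
      and sum: "\<forall>f\<in>\<Gamma>. Z f = (\<Sum>k=0..N. V k f)" for V
  proof (rule PiE_ext[OF V])
    show "(\<lambda>k\<in>{0..N}. restrict (W k) \<Gamma>) \<in> (\<Pi>\<^sub>E k\<in>{0..N}. {Y \<in> PV d \<Gamma>. homogeneous_on k \<Gamma> Y})"
      by fact
    fix k assume k: "k \<in> {0..N}"
    have Vk: "V l \<in> PV d \<Gamma>" "homogeneous_on l \<Gamma> (V l)" if "l \<le> N" for l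
      using PiE_mem[OF V, of l] that by auto
    have "V k = restrict (W k) \<Gamma>"
    proof (rule extensionalityI[of _ \<Gamma>])
      show "V k \<in> extensional \<Gamma>" using Vk k by (simp add: PV_def)
      show "restrict (W k) \<Gamma> \<in> extensional \<Gamma>" by simp
      fix f assume f: "f \<in> \<Gamma>"
      \<comment> \<open>Any decomposition into homogeneous parts expands \<open>Z (i f)\<close> in
        powers of \<open>i\<close>, so the weights force its \<open>k\<close>-th member to equal
        \<open>W k f\<close>.\<close>
      have "Z (\<lambda>x. ereal (real i) * f x) = (\<Sum>l\<le>N. real i ^ l *\<^sub>R V l f)" if "i \<in> {1..Suc N}" for i
      proof -
        have "Z (\<lambda>x. ereal (real i) * f x) = (\<Sum>l=0..N. V l (\<lambda>x. ereal (real i) * f x))"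
          using sum scale[OF f, of "real i"] that by simp
        also have "\<dots> = (\<Sum>l\<le>N. real i ^ l *\<^sub>R V l f)"
          unfolding atLeast0AtMost using Vk(2) f that
          by (intro sum.cong refl) (simp add: homogeneous_on_def)
        finally show ?thesis .
      qed
      then have "W k f = (\<Sum>i = 1..Suc N. w k i *\<^sub>R (\<Sum>l\<le>N. real i ^ l *\<^sub>R V l f))"
        unfolding W_def by (intro sum.cong refl) simp
      also have "\<dots> = V k f" using k by (intro weights_extract[OF w]) auto
      finally show "V k f = restrict (W k) \<Gamma> f" using f by simp
    qed
    then show "V k = (\<lambda>k\<in>{0..N}. restrict (W k) \<Gamma>) k" using k by simp
  qed
  ultimately show ?thesis unfolding N_def[symmetric] by (intro ex1I[of _ "\<lambda>k\<in>{0..N}. restrict (W k) \<Gamma>"]) blast+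
qed

end
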